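(* Let $\Omega\subset\mathbb R^n$ be an open set, let $(X,d,z_0)$ be a pointed complete metric space, and let $f:\Omega\to X$ be a Lipschitz continuous mapping. Then: (i) there exists a map $\nabla^{\circ}f:\Omega\to\mathcal L(\mathbb R^n;(\mathrm{Lip}_{z_0}(X))^* )$ such that for every $\varphi\in\mathrm{Lip}_{z_0}(X)$ and every $\nu\in\mathbb R^n$ $$\langle\varphi,\nabla^{\circ}f(x)\cdot\nu\rangle=\nabla(\varphi\circ f)(x)\cdot\nu$$ at every $x\in\Omega$ at which $\varphi\circ f$ is classically differentiable; and (ii) there exists a seminorm $\rho$ on $(\mathrm{Lip}_{z_0}(X))^*$ such that for every $\nu\in\mathbb R^n$ $$\mathrm{md}(f,x)(\nu)=\rho(\nabla^{\circ}f(x)\cdot\nu)$$ for almost every $x\in\Omega$, where $\nabla^{\circ}f$ is the map in (i).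
   Context: $\mathrm{Lip}_{z_0}(X)$ is the Banach space of all real-valued Lipschitz functions on $X$ vanishing at the base point $z_0$, with norm $\mathrm{Lip}(\varphi)=\sup\{|\varphi(x)-\varphi(y)|/d(x,y): x,y\in X,\ x\neq y\}$; $(\mathrm{Lip}_{z_0}(X))^*$ is its Banach dual, and $\langle\varphi,\Lambda\rangle:=\Lambda(\varphi)$. $\mathcal L(\mathbb R^n;W)$ denotes the bounded linear operators from $\mathbb R^n$ to the normed space $W$, and $T\cdot\nu$ is $T$ applied to $\nu$. A map $f:\Omega\to X$ is metrically differentiable at $x\in\Omega$ if there is a seminorm $\sigma_x:\mathbb R^n\to[0,\infty)$ with $d(f(y),f(x))-\sigma_x(y-x)=o(|y-x|)$ as $y\to x$; this seminorm is then denoted $\mathrm{md}(f,x)(\cdot)$ and called the metric differential. (A Lipschitz continuous map $f:\Omega\to X$ is metrically differentiable at almost every point of $\Omega$, by a theorem of Kirchheim.) "Almost every" refers to Lebesgue measure. *)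

theory Defs
  imports "HOL-Analysis.Analysis" "HOL-Library.Landau_Symbols"
begin

section \<open>Pointed metric spaces\<close>

class pointed_metric_space = metric_space +
  fixes base_point :: 'a

class complete_pointed_metric_space = pointed_metric_space + complete_space

section \<open>The Banach space of Lipschitz functions vanishing at the base point\<close>

typedef (overloaded) 'a lip0 =
  "{\<phi> :: 'a::pointed_metric_space \<Rightarrow> real. (\<exists>C. C-lipschitz_on UNIV \<phi>) \<and> \<phi> base_point = 0}"
  morphisms lip0_apply Lip0
  by (rule exI[of _ "\<lambda>_. 0"]) (auto intro!: exI[of _ 0] lipschitz_onI)

setup_lifting type_definition_lip0

text \<open>Adding 0 to the set of difference quotients is only relevant for a one-point space, where
  that set is empty and its supremum in the reals would be unspecified.\<close>

definition Lip_const :: "('a::metric_space \<Rightarrow> real) \<Rightarrow> real" where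
  "Lip_const \<phi> = Sup (insert 0 {\<bar>\<phi> x - \<phi> y\<bar> / dist x y | x y. x \<noteq> y})"

lemma Lip_const_bounds:
  assumes "\<exists>C. C-lipschitz_on UNIV \<phi>"
  shows Lip_const_nonneg: "0 \<le> Lip_const \<phi>"
    and Lip_const_bound: "\<bar>\<phi> x - \<phi> y\<bar> \<le> Lip_const \<phi> * dist x y"
proof -
  let ?S = "insert 0 {\<bar>\<phi> x - \<phi> y\<bar> / dist x y | x y. x \<noteq> y}"
  obtain C where C: "C-lipschitz_on UNIV \<phi>"
    using assms by blast
  have "s \<le> C" if "s \<in> ?S" for s
    using that lipschitz_onD[OF C] lipschitz_on_nonneg[OF C]
    by (auto simp: dist_real_def divide_le_eq)
  then have bdd: "bdd_above ?S"
    by (rule bdd_aboveI)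
  show "0 \<le> Lip_const \<phi>"
    unfolding Lip_const_def by (rule cSup_upper[OF _ bdd]) simp
  show "\<bar>\<phi> x - \<phi> y\<bar> \<le> Lip_const \<phi> * dist x y"
  proof (cases "x = y")
    case False
    then have "\<bar>\<phi> x - \<phi> y\<bar> / dist x y \<le> Lip_const \<phi>"
      unfolding Lip_const_def by (intro cSup_upper[OF _ bdd]) blast
    with False show ?thesis
      by (simp add: divide_le_eq)
  qed simp
qed

lemma Lip_const_le:
  assumes "0 \<le> C" "\<And>x y. \<bar>\<phi> x - \<phi> y\<bar> \<le> C * dist x y"
  shows "Lip_const \<phi> \<le> C"
  unfolding Lip_const_def
  by (rule cSup_least) (use assms in \<open>auto simp: divide_le_eq\<close>)

lemma Lip_const_zero: "Lip_const (\<lambda>_. 0) = 0"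
proof (rule antisym)
  show "Lip_const (\<lambda>_::'a. 0) \<le> 0"
    by (rule Lip_const_le) simp_all
  show "0 \<le> Lip_const (\<lambda>_::'a. 0)"
    by (rule Lip_const_nonneg) (auto intro!: exI[of _ 0] lipschitz_onI)
qed

lemma lipschitz_realI:
  fixes \<phi> :: "'a::metric_space \<Rightarrow> real"
  assumes "0 \<le> C" "\<And>x y. \<bar>\<phi> x - \<phi> y\<bar> \<le> C * dist x y"
  shows "\<exists>C. C-lipschitz_on UNIV \<phi>"
  using assms by (auto intro!: exI[of _ C] lipschitz_onI simp: dist_real_def)

lemma Lip_add_bound:
  assumes "\<exists>C. C-lipschitz_on UNIV \<phi>" "\<exists>C. C-lipschitz_on UNIV \<psi>"
  shows "\<bar>(\<phi> x + \<psi> x) - (\<phi> y + \<psi> y)\<bar> \<le> (Lip_const \<phi> + Lip_const \<psi>) * dist x y"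
  using Lip_const_bound[OF assms(1), of x y] Lip_const_bound[OF assms(2), of x y]
  by (simp add: algebra_simps)

lemma Lip_scale_bound:
  assumes "\<exists>C. C-lipschitz_on UNIV \<phi>"
  shows "\<bar>r * \<phi> x - r * \<phi> y\<bar> \<le> (\<bar>r\<bar> * Lip_const \<phi>) * dist x y"
  using mult_left_mono[OF Lip_const_bound[OF assms, of x y] abs_ge_zero[of r]]
  by (simp add: abs_mult[symmetric] right_diff_distrib mult.assoc)

lemma lipschitz_add:
  fixes \<phi> \<psi> :: "'a::metric_space \<Rightarrow> real"
  assumes "\<exists>C. C-lipschitz_on UNIV \<phi>" "\<exists>C. C-lipschitz_on UNIV \<psi>"
  shows "\<exists>C. C-lipschitz_on UNIV (\<lambda>x. \<phi> x + \<psi> x)"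
  by (rule lipschitz_realI[OF _ Lip_add_bound[OF assms]])
     (intro add_nonneg_nonneg Lip_const_nonneg assms)

lemma lipschitz_scale:
  fixes \<phi> :: "'a::metric_space \<Rightarrow> real"
  assumes "\<exists>C. C-lipschitz_on UNIV \<phi>"
  shows "\<exists>C. C-lipschitz_on UNIV (\<lambda>x. r * \<phi> x)"
  by (rule lipschitz_realI[OF _ Lip_scale_bound[OF assms]])
     (intro mult_nonneg_nonneg abs_ge_zero Lip_const_nonneg assms)

lemma Lip_const_add:
  assumes "\<exists>C. C-lipschitz_on UNIV \<phi>" "\<exists>C. C-lipschitz_on UNIV \<psi>"
  shows "Lip_const (\<lambda>x. \<phi> x + \<psi> x) \<le> Lip_const \<phi> + Lip_const \<psi>"
  by (rule Lip_const_le[OF _ Lip_add_bound[OF assms]])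
     (intro add_nonneg_nonneg Lip_const_nonneg assms)

lemma Lip_const_scale:
  assumes L: "\<exists>C. C-lipschitz_on UNIV \<phi>"
  shows "Lip_const (\<lambda>x. r * \<phi> x) = \<bar>r\<bar> * Lip_const \<phi>"
proof (rule antisym)
  show "Lip_const (\<lambda>x. r * \<phi> x) \<le> \<bar>r\<bar> * Lip_const \<phi>"
    by (rule Lip_const_le[OF _ Lip_scale_bound[OF L]])
       (intro mult_nonneg_nonneg abs_ge_zero Lip_const_nonneg L)
  note L' = lipschitz_scale[OF L, of r]
  show "\<bar>r\<bar> * Lip_const \<phi> \<le> Lip_const (\<lambda>x. r * \<phi> x)"
  proof (cases "r = 0")
    case True
    then show ?thesis using Lip_const_nonneg[OF L'] by simp
  next
    case False
    have "Lip_const \<phi> \<le> Lip_const (\<lambda>x. r * \<phi> x) / \<bar>r\<bar>"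
    proof (rule Lip_const_le)
      show "0 \<le> Lip_const (\<lambda>x. r * \<phi> x) / \<bar>r\<bar>"
        using Lip_const_nonneg[OF L'] by simp
      fix x y
      have "\<bar>r\<bar> * \<bar>\<phi> x - \<phi> y\<bar> \<le> Lip_const (\<lambda>x. r * \<phi> x) * dist x y"
        using Lip_const_bound[OF L', of x y]
        by (simp add: abs_mult[symmetric] right_diff_distrib)
      then show "\<bar>\<phi> x - \<phi> y\<bar> \<le> Lip_const (\<lambda>x. r * \<phi> x) / \<bar>r\<bar> * dist x y"
        using False by (simp add: field_simps)
    qed
    then show ?thesis using False by (simp add: field_simps)
  qed
qed

instantiation lip0 :: (pointed_metric_space) real_normed_vector
begin

lift_definition norm_lip0 :: "'a lip0 \<Rightarrow> real" is Lip_const .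

lift_definition zero_lip0 :: "'a lip0" is "\<lambda>_. 0"
  by (auto intro!: exI[of _ 0] lipschitz_onI)

lift_definition plus_lip0 :: "'a lip0 \<Rightarrow> 'a lip0 \<Rightarrow> 'a lip0" is "\<lambda>\<phi> \<psi> x. \<phi> x + \<psi> x"
  by (auto intro: lipschitz_add)

lift_definition scaleR_lip0 :: "real \<Rightarrow> 'a lip0 \<Rightarrow> 'a lip0" is "\<lambda>r \<phi> x. r * \<phi> x"
  by (auto intro: lipschitz_scale)

lift_definition uminus_lip0 :: "'a lip0 \<Rightarrow> 'a lip0" is "\<lambda>\<phi> x. - \<phi> x"
  using lipschitz_scale[where r = "-1"] by simp

lift_definition minus_lip0 :: "'a lip0 \<Rightarrow> 'a lip0 \<Rightarrow> 'a lip0" is "\<lambda>\<phi> \<psi> x. \<phi> x - \<psi> x"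
  proof -
  fix \<phi> \<psi> :: "'a \<Rightarrow> real"
  assume "(\<exists>C. C-lipschitz_on UNIV \<phi>) \<and> \<phi> base_point = 0"
    and "(\<exists>C. C-lipschitz_on UNIV \<psi>) \<and> \<psi> base_point = 0"
  then show "(\<exists>C. C-lipschitz_on UNIV (\<lambda>x. \<phi> x - \<psi> x)) \<and> \<phi> base_point - \<psi> base_point = 0"
    using lipschitz_add[of \<phi> "\<lambda>x. -1 * \<psi> x"] lipschitz_scale[of \<psi> "-1"] by simp
qed

definition dist_lip0 :: "'a lip0 \<Rightarrow> 'a lip0 \<Rightarrow> real"
  where "dist_lip0 \<phi> \<psi> = norm (\<phi> - \<psi>)"

definition
  "(uniformity :: ('a lip0 \<times> 'a lip0) filter) = (INF e\<in>{0 <..}. principal {(x, y). dist x y < e})"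

definition open_lip0 :: "'a lip0 set \<Rightarrow> bool"
  where "open_lip0 S = (\<forall>x\<in>S. \<forall>\<^sub>F (x', y) in uniformity. x' = x \<longrightarrow> y \<in> S)"

definition sgn_lip0 :: "'a lip0 \<Rightarrow> 'a lip0"
  where "sgn_lip0 \<phi> = inverse (norm \<phi>) *\<^sub>R \<phi>"

instance
proof
  fix \<phi> \<psi> \<chi> :: "'a lip0" and r s :: real
  show "norm \<phi> = 0 \<longleftrightarrow> \<phi> = 0"
  proof
    assume "norm \<phi> = 0"
    then show "\<phi> = 0"
    proof (transfer, intro ext)
      fix \<phi> :: "'a \<Rightarrow> real" and x
      assume "(\<exists>C. C-lipschitz_on UNIV \<phi>) \<and> \<phi> base_point = 0" "Lip_const \<phi> = 0"
      then show "\<phi> x = 0"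
        using Lip_const_bound[of \<phi> x base_point] by simp
    qed
  next
    assume "\<phi> = 0"
    then show "norm \<phi> = 0"
      by transfer (simp add: Lip_const_zero)
  qed
  show "norm (\<phi> + \<psi>) \<le> norm \<phi> + norm \<psi>"
    by transfer (auto intro!: Lip_const_add)
  show "norm (r *\<^sub>R \<phi>) = \<bar>r\<bar> * norm \<phi>"
    by transfer (auto intro!: Lip_const_scale)
  show "dist \<phi> \<psi> = norm (\<phi> - \<psi>)"
    by (rule dist_lip0_def)
  show "sgn \<phi> = inverse (norm \<phi>) *\<^sub>R \<phi>"
    by (rule sgn_lip0_def)
  show "(uniformity :: ('a lip0 \<times> 'a lip0) filter) = (INF e\<in>{0 <..}. principal {(x, y). dist x y < e})"
    by (rule uniformity_lip0_def)
  show "open U = (\<forall>x\<in>U. \<forall>\<^sub>F (x', y) in uniformity. x' = x \<longrightarrow> y \<in> U)" for U :: "'a lip0 set"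
    by (rule open_lip0_def)
qed (transfer, force simp: algebra_simps)+

end

lemma lip0_apply_bound: "\<bar>lip0_apply \<phi> x - lip0_apply \<phi> y\<bar> \<le> norm \<phi> * dist x y"
  by transfer (auto intro: Lip_const_bound)

lemma lip0_apply_base_point [simp]: "lip0_apply \<phi> base_point = 0"
  by transfer simp

lemma lip0_apply_minus: "lip0_apply (\<phi> - \<psi>) x = lip0_apply \<phi> x - lip0_apply \<psi> x"
  by transfer simp

lemma norm_lip0_le:
  assumes "0 \<le> C" "\<And>x y. \<bar>lip0_apply \<phi> x - lip0_apply \<phi> y\<bar> \<le> C * dist x y"
  shows "norm \<phi> \<le> C"
  unfolding norm_lip0.rep_eq by (rule Lip_const_le[OF assms])

instance lip0 :: (pointed_metric_space) banach
proof
  fix X :: "nat \<Rightarrow> 'a lip0"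
  assume X: "Cauchy X"
  have "Cauchy (\<lambda>n. lip0_apply (X n) x)" for x
  proof (rule metric_CauchyI)
    fix e :: real
    assume "0 < e"
    define c where "c = e / (dist x base_point + 1)"
    have "0 < dist x base_point + 1"
      using zero_le_dist[of x base_point] by linarith
    then have "0 < c" and c: "c * (dist x base_point + 1) = e"
      using \<open>0 < e\<close> by (simp_all add: c_def)
    then obtain M where M: "\<And>m n. m \<ge> M \<Longrightarrow> n \<ge> M \<Longrightarrow> norm (X m - X n) < c"
      using CauchyD[OF X] by metis
    have "dist (lip0_apply (X m) x) (lip0_apply (X n) x) < e" if "m \<ge> M" "n \<ge> M" for m n
    proof -
      have "dist (lip0_apply (X m) x) (lip0_apply (X n) x) \<le> norm (X m - X n) * dist x base_point"
        using lip0_apply_bound[of "X m - X n" x base_point]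
        by (simp add: lip0_apply_minus dist_real_def)
      also have "\<dots> \<le> c * dist x base_point"
        using M[OF that] by (intro mult_right_mono) auto
      also have "\<dots> < e"
        using c \<open>0 < c\<close> by (simp add: distrib_left)
      finally show ?thesis .
    qed
    then show "\<exists>M. \<forall>m\<ge>M. \<forall>n\<ge>M. dist (lip0_apply (X m) x) (lip0_apply (X n) x) < e"
      by blast
  qed
  then have "\<forall>x. \<exists>l. (\<lambda>n. lip0_apply (X n) x) \<longlonglongrightarrow> l"
    by (simp add: Cauchy_convergent_iff convergent_def)
  then obtain g where g: "\<And>x. (\<lambda>n. lip0_apply (X n) x) \<longlonglongrightarrow> g x"
    by metis
  obtain K where K: "\<And>n. norm (X n) \<le> K"
    using Cauchy_Bseq[OF X] by (auto simp: Bseq_def)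
  have K0: "0 \<le> K"
    using K[of 0] norm_ge_zero[of "X 0"] by linarith
  have "\<bar>g x - g y\<bar> \<le> K * dist x y" for x y
  proof (rule LIMSEQ_le_const2)
    show "(\<lambda>n. \<bar>lip0_apply (X n) x - lip0_apply (X n) y\<bar>) \<longlonglongrightarrow> \<bar>g x - g y\<bar>"
      by (intro tendsto_intros g)
    show "\<exists>N. \<forall>n\<ge>N. \<bar>lip0_apply (X n) x - lip0_apply (X n) y\<bar> \<le> K * dist x y"
      using lip0_apply_bound K mult_right_mono[OF K zero_le_dist] by (meson order_trans)
  qed
  then have "\<exists>C. C-lipschitz_on UNIV g"
    using K0 by (rule lipschitz_realI[rotated])
  moreover have "g base_point = 0"
    using g[of base_point] by (simp add: LIMSEQ_const_iff)
  ultimately have G: "lip0_apply (Lip0 g) = g"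
    by (simp add: Lip0_inverse)
  have "X \<longlonglongrightarrow> Lip0 g"
  proof (rule LIMSEQ_I)
    fix r :: real
    assume "0 < r"
    then obtain M where M: "\<And>m n. m \<ge> M \<Longrightarrow> n \<ge> M \<Longrightarrow> norm (X m - X n) < r / 2"
      using CauchyD[OF X, of "r / 2"] by auto
    have "norm (X n - Lip0 g) \<le> r / 2" if n: "n \<ge> M" for n
    proof (rule norm_lip0_le)
      fix x y
      show "\<bar>lip0_apply (X n - Lip0 g) x - lip0_apply (X n - Lip0 g) y\<bar> \<le> r / 2 * dist x y"
      proof (rule LIMSEQ_le_const2)
        show "(\<lambda>m. \<bar>lip0_apply (X n - X m) x - lip0_apply (X n - X m) y\<bar>)
            \<longlonglongrightarrow> \<bar>lip0_apply (X n - Lip0 g) x - lip0_apply (X n - Lip0 g) y\<bar>"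
          unfolding lip0_apply_minus G by (intro tendsto_intros g)
        have "\<bar>lip0_apply (X n - X m) x - lip0_apply (X n - X m) y\<bar> \<le> r / 2 * dist x y"
          if "m \<ge> M" for m
          using lip0_apply_bound[of "X n - X m" x y]
            mult_right_mono[OF less_imp_le[OF M[OF n that]] zero_le_dist[of x y]]
          by linarith
        then show "\<exists>N. \<forall>m\<ge>N. \<bar>lip0_apply (X n - X m) x - lip0_apply (X n - X m) y\<bar> \<le> r / 2 * dist x y"
          by blast
      qed
    qed (use \<open>0 < r\<close> in simp)
    then show "\<exists>no. \<forall>n\<ge>no. norm (X n - Lip0 g) < r"
      using \<open>0 < r\<close> by (intro exI[of _ M]) (force dest: order_le_less_trans)
  qed
  then show "convergent X"
    by (rule convergentI)
qed

type_synonym 'a lip0_dual = "'a lip0 \<Rightarrow>\<^sub>L real"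

section \<open>Seminorms and metric differentials\<close>

definition seminorm :: "('v::real_vector \<Rightarrow> real) \<Rightarrow> bool" where
  "seminorm p \<longleftrightarrow>
     (\<forall>v. 0 \<le> p v) \<and> (\<forall>v w. p (v + w) \<le> p v + p w) \<and> (\<forall>c v. p (c *\<^sub>R v) = \<bar>c\<bar> * p v)"

text \<open>A map defined on an open set is represented by a total function; at a point of the open set
  the filter \<^term>\<open>at x\<close> only sees the values of the function on that set.\<close>

definition has_metric_differential ::
  "(real ^ 'n \<Rightarrow> 'a::metric_space) \<Rightarrow> (real ^ 'n \<Rightarrow> real) \<Rightarrow> real ^ 'n \<Rightarrow> bool" where
  "has_metric_differential f \<sigma> x \<longleftrightarrow>
     seminorm \<sigma> \<and> (\<lambda>y. dist (f y) (f x) - \<sigma> (y - x)) \<in> o[at x](\<lambda>y. norm (y - x))"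

definition metrically_differentiable ::
  "(real ^ 'n \<Rightarrow> 'a::metric_space) \<Rightarrow> real ^ 'n \<Rightarrow> bool" where
  "metrically_differentiable f x \<longleftrightarrow> (\<exists>\<sigma>. has_metric_differential f \<sigma> x)"

text \<open>The description is meaningful where \<open>f\<close> is metrically differentiable, by
  uniqueness of the seminorm (lemma \<open>has_metric_differential_unique\<close>).\<close>

definition md :: "(real ^ 'n \<Rightarrow> 'a::metric_space) \<Rightarrow> real ^ 'n \<Rightarrow> real ^ 'n \<Rightarrow> real" where
  "md f x = (THE \<sigma>. has_metric_differential f \<sigma> x)"

lemma has_metric_differential_unique:
  fixes f :: "real ^ 'n \<Rightarrow> 'a::metric_space"
  assumes "has_metric_differential f \<sigma> x" "has_metric_differential f \<tau> x"
  shows "\<sigma> = \<tau>"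
proof
  fix v :: "real ^ 'n"
  have \<sigma>: "seminorm \<sigma>" and \<tau>: "seminorm \<tau>"
    using assms by (auto simp: has_metric_differential_def)
  have hom: "\<sigma> (c *\<^sub>R w) = \<bar>c\<bar> * \<sigma> w" "\<tau> (c *\<^sub>R w) = \<bar>c\<bar> * \<tau> w" for c w
    using \<sigma> \<tau> by (auto simp: seminorm_def)
  have "(\<lambda>y. (dist (f y) (f x) - \<tau> (y - x)) - (dist (f y) (f x) - \<sigma> (y - x)))
      \<in> o[at x](\<lambda>y. norm (y - x))"
    by (rule sum_in_smallo) (use assms in \<open>auto simp: has_metric_differential_def\<close>)
  then have o: "(\<lambda>y. \<sigma> (y - x) - \<tau> (y - x)) \<in> o[at x](\<lambda>y. norm (y - x))"
    by simp
  show "\<sigma> v = \<tau> v"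
  proof (cases "v = 0")
    case True
    then show ?thesis using hom[of 0 0] by simp
  next
    case False
    have "\<bar>\<sigma> v - \<tau> v\<bar> \<le> c * norm v" if "0 < c" for c
    proof -
      obtain d where d: "0 < d"
        "\<And>y. y \<noteq> x \<Longrightarrow> dist y x < d \<Longrightarrow> \<bar>\<sigma> (y - x) - \<tau> (y - x)\<bar> \<le> c * norm (y - x)"
        using landau_o.smallD[OF o \<open>0 < c\<close>] by (auto simp: eventually_at)
      define t where "t = d / (2 * norm v)"
      have t: "0 < t" "t * norm v < d"
        using False d(1) by (auto simp: t_def)
      have "\<bar>\<sigma> (t *\<^sub>R v) - \<tau> (t *\<^sub>R v)\<bar> \<le> c * norm (t *\<^sub>R v)"
        using d(2)[of "x + t *\<^sub>R v"] t False by (simp add: dist_norm)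
      moreover have "\<bar>\<sigma> (t *\<^sub>R v) - \<tau> (t *\<^sub>R v)\<bar> = t * \<bar>\<sigma> v - \<tau> v\<bar>"
        using t(1) by (simp add: hom right_diff_distrib[symmetric] abs_mult)
      ultimately have "t * \<bar>\<sigma> v - \<tau> v\<bar> \<le> t * (c * norm v)"
        using t(1) by (simp add: mult.left_commute)
      then show ?thesis using t(1) by simp
    qed
    then have "\<bar>\<sigma> v - \<tau> v\<bar> \<le> 0 + e" if "0 < e" for e
      using that False by (metis add_0 divide_pos_pos nonzero_eq_divide_eq norm_eq_zero zero_less_norm_iff)
    then have "\<bar>\<sigma> v - \<tau> v\<bar> \<le> 0"
      by (rule field_le_epsilon)
    then show ?thesis by simp
  qed
qed

lemma md_eq:
  assumes "has_metric_differential f \<sigma> x"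
  shows "md f x = \<sigma>"
  unfolding md_def using assms has_metric_differential_unique by blast

end

theory Submission
  imports Defs
begin

text \<open>Let \<open>p\<^sub>j\<close> be dense in the image of \<open>f\<close> and \<open>\<phi>\<^sub>j = d(\<cdot>, p\<^sub>j) - d(z\<^sub>0, p\<^sub>j)\<close>. The seminorm is
  \<open>\<rho>(\<Lambda>) = sup\<^sub>j \<bar>\<Lambda>(\<phi>\<^sub>j)\<bar>\<close>. Since \<open>d(f(x), f(y)) = sup\<^sub>j \<bar>\<phi>\<^sub>j(f(x)) - \<phi>\<^sub>j(f(y))\<bar>\<close>, everything
  reduces to a simultaneous Rademacher theorem for the sequence \<open>h\<^sub>j = \<phi>\<^sub>j \<circ> f\<close>: almost everywhere all
  \<open>h\<^sub>j\<close> are differentiable and the increment of \<open>sup\<^sub>j \<bar>h\<^sub>j(y) - h\<^sub>j(x)\<bar>\<close> is \<open>sup\<^sub>j \<bar>\<nabla>h\<^sub>j(x) \<cdot> (y - x)\<bar>\<close>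
  up to \<open>o(\<bar>y - x\<bar>)\<close>. On a line, \<open>\<bar>h\<^sub>j(b) - h\<^sub>j(a)\<bar>\<close> is bounded by the integral over \<open>[a,b]\<close> of
  \<open>m = sup\<^sub>j \<bar>h\<^sub>j'\<bar>\<close>, so the claim holds at the Lebesgue points of \<open>m\<close>; Tonelli and translation
  invariance transfer this to every direction in \<open>\<real>\<^sup>n\<close>, a recurrence argument makes the directional
  derivatives additive, and compactness of the sphere makes the expansion uniform in the direction.
  The map \<open>\<nabla>\<^sup>\<circ>f\<close> itself is, in each coordinate direction, a weak-star cluster point of the difference
  quotients \<open>(\<delta>\<^bsub>f(x + t e)\<^esub> - \<delta>\<^bsub>f(x)\<^esub>) / t\<close>.\<close>

section \<open>Differentiation of measures on the line\<close>

lemma AE_lborel_not_in_negligible: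
  assumes "negligible B"
  shows "AE x in lborel. x \<notin> B"
  using AE_not_in[OF assms[unfolded negligible_iff_null_sets]] by (simp only: AE_completion_iff)

text \<open>Countable additivity on both sides carries the bound from the single intervals to their
  union; this is how the intervals of a Vitali family are summed.\<close>

lemma emeasure_interval_Union_le:
  fixes N :: "real measure" and e :: real
  assumes N: "sets N = sets borel" and "0 < e" and "countable C"
    and disj: "disjoint_family_on (\<lambda>i. {fst i..snd i}) C"
    and big: "\<And>i. i \<in> C \<Longrightarrow> ennreal (e * (snd i - fst i)) \<le> emeasure N {fst i..snd i}"
    and ord: "\<And>i. i \<in> C \<Longrightarrow> fst i \<le> snd i"
  shows "ennreal e * emeasure lborel (\<Union>i\<in>C. {fst i..snd i}) \<le> emeasure N (\<Union>i\<in>C. {fst i..snd i})"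
proof -
  have "ennreal e * emeasure lborel (\<Union>i\<in>C. {fst i..snd i})
      = ennreal e * (\<integral>\<^sup>+i. emeasure lborel {fst i..snd i} \<partial>count_space C)"
    using assms by (subst emeasure_UN_countable) auto
  also have "\<dots> = (\<integral>\<^sup>+i. ennreal e * emeasure lborel {fst i..snd i} \<partial>count_space C)"
    by (subst nn_integral_cmult) auto
  also have "\<dots> \<le> (\<integral>\<^sup>+i. emeasure N {fst i..snd i} \<partial>count_space C)"
    using big ord \<open>0 < e\<close> by (intro nn_integral_mono) (auto simp: ennreal_mult)
  also have "\<dots> = emeasure N (\<Union>i\<in>C. {fst i..snd i})"
    using assms by (subst emeasure_UN_countable) auto
  finally show ?thesis .
qed

text \<open>A Vitali covering argument. Outer regularity puts \<open>A\<close> into an open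
  \<open>U\<close> of \<open>N\<close>-mass below \<open>e * \<eta>\<close>; disjoint intervals
  inside \<open>U\<close> on which \<open>N\<close> exceeds \<open>e\<close> times the length have
  total length below \<open>\<eta>\<close> and cover almost all of the set. That set is not known to
  be measurable, hence the criterion by outer approximation.\<close>

lemma negligible_large_upper_density:
  fixes N :: "real measure" and e :: real
  assumes N: "sets N = sets borel" and fin: "emeasure N UNIV \<noteq> \<infinity>"
    and A: "A \<in> sets borel" "emeasure N A = 0" and "0 < e"
  shows "negligible {t \<in> A. \<forall>d>0. \<exists>a b. a < b \<and> t \<in> {a..b} \<and> b - a < d \<and>
           ennreal (e * (b - a)) < emeasure N {a..b}}" (is "negligible ?B")
proof (unfold negligible_outer_le, intro allI impI)
  fix \<eta> :: real assume "0 < \<eta>"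
  have "(INF U\<in>{U. A \<subseteq> U \<and> open U}. emeasure N U) = 0"
    using outer_regular[of N A] N fin A by (simp add: sets_eq_imp_space_eq[OF N])
  then have "(INF U\<in>{U. A \<subseteq> U \<and> open U}. emeasure N U) < ennreal (e * \<eta>)"
    using \<open>0 < \<eta>\<close> \<open>0 < e\<close> by (simp add: ennreal_zero_less_mult_iff)
  then obtain U where U: "A \<subseteq> U" "open U" "emeasure N U < ennreal (e * \<eta>)"
    by (auto simp: INF_less_iff)
  define K where "K = {i. fst i < snd i \<and> {fst i..snd i} \<subseteq> U \<and>
    ennreal (e * (snd i - fst i)) < emeasure N {fst i..snd i}}"
  \<comment> \<open>Intervals are coded by pairs of endpoints; this equation turns the closed balls
    of the Vitali theorem into intervals.\<close>
  have cb: "cball ((fst i + snd i) / 2) ((snd i - fst i) / 2) = {fst i..snd i}" for i :: "real \<times> real"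
    by (auto simp: dist_real_def abs_le_iff field_simps)
  obtain C where C: "countable C" "C \<subseteq> K"
     "pairwise (\<lambda>i j. disjnt {fst i..snd i} {fst j..snd j}) C"
     "negligible (?B - (\<Union>i \<in> C. {fst i..snd i}))"
  proof (rule Vitali_covering_theorem_cballs[of K "\<lambda>i. (snd i - fst i) / 2" ?B "\<lambda>i. (fst i + snd i) / 2", unfolded cb])
    fix i assume "i \<in> K"
    then show "0 < (snd i - fst i) / 2" by (auto simp: K_def)
  next
    fix t d :: real assume t: "t \<in> ?B" and "0 < d"
    then obtain r where r: "0 < r" "ball t r \<subseteq> U"
      using U(1) openE[OF U(2), of t] by blast
    \<comment> \<open>The bound \<open>d\<close> is what the Vitali theorem demands, while
      \<open>r\<close> keeps the interval inside \<open>ball t r\<close> and so inside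
      \<open>U\<close>.\<close>
    obtain a b where ab: "a < b" "t \<in> {a..b}" "b - a < min d r" "ennreal (e * (b - a)) < emeasure N {a..b}"
      using t \<open>0 < d\<close> r(1) by (auto dest: spec[of _ "min d r"])
    then have "{a..b} \<subseteq> U"
      using r by (auto simp: dist_real_def subset_iff)
    with ab have "(a, b) \<in> K" by (auto simp: K_def)
    with ab show "\<exists>i. i \<in> K \<and> t \<in> {fst i..snd i} \<and> (snd i - fst i) / 2 < d"
      by (intro exI[of _ "(a, b)"]) auto
  qed
  let ?V = "\<Union>i\<in>C. {fst i..snd i}"
  have V: "?V \<in> sets borel" using C(1) by auto
  have CD: "fst i < snd i" "{fst i..snd i} \<subseteq> U"
    "ennreal (e * (snd i - fst i)) < emeasure N {fst i..snd i}" if "i \<in> C" for i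
    using C(2) that unfolding K_def by blast+
  have "ennreal e * emeasure lborel ?V \<le> emeasure N ?V"
    using N \<open>0 < e\<close> C(1,3) CD
    by (intro emeasure_interval_Union_le)
       (simp_all add: disjoint_family_on_def pairwise_def disjnt_def less_imp_le)
  also have "\<dots> \<le> emeasure N U"
    using CD(2) U(2) N by (intro emeasure_mono UN_least) simp_all
  finally have *: "ennreal e * emeasure lborel ?V < ennreal e * ennreal \<eta>"
    using U(3) \<open>0 < e\<close> \<open>0 < \<eta>\<close> by (simp add: ennreal_mult)
  then have V\<eta>: "emeasure lborel ?V < ennreal \<eta>"
    by (metis mult_left_mono not_le zero_le)
  have VL: "?V \<in> lmeasurable"
    using V V\<eta> by (intro fmeasurableI) (auto simp: order.strict_trans)
  have mV: "measure lebesgue ?V \<le> \<eta>"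
    unfolding measure_def using V\<eta> V \<open>0 < \<eta>\<close> by (intro enn2real_leI) (simp_all add: less_imp_le)
  have nl: "?B - ?V \<in> null_sets lebesgue"
    using C(4) by (simp add: negligible_iff_null_sets)
  show "\<exists>T. ?B \<subseteq> T \<and> T \<in> lmeasurable \<and> measure lebesgue T \<le> \<eta>"
  proof (intro exI conjI)
    show "?B \<subseteq> ?V \<union> (?B - ?V)" by blast
    show "?V \<union> (?B - ?V) \<in> lmeasurable"
      using VL nl by (intro fmeasurable.Un) (auto simp: fmeasurableI_null_sets)
    show "measure lebesgue (?V \<union> (?B - ?V)) \<le> \<eta>"
      using mV VL nl by (subst measure_Un_null_set) auto
  qed
qed

text \<open>Restricted to a window \<open>{-k..k}\<close> the measure is finite, so the previous
  lemma applies. Windows and thresholds \<open>1 / (n + 1)\<close> are countably many, so their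
  exceptional sets fit into one null set.\<close>

lemma AE_null_set_density_zero:
  fixes N :: "real measure"
  assumes N: "sets N = sets borel" and fin: "\<And>a b. emeasure N {a..b} \<noteq> \<infinity>"
    and A: "A \<in> sets borel" "emeasure N A = 0"
  shows "AE t in lborel. t \<in> A \<longrightarrow> (\<forall>e>0. \<exists>d>0. \<forall>a b. a < b \<and> t \<in> {a..b} \<and> b - a < d \<longrightarrow>
           emeasure N {a..b} \<le> ennreal (e * (b - a)))"
proof -
  define M where "M k = density N (indicator {-real k..real k})" for k :: nat
  have M: "emeasure (M k) X = emeasure N ({-real k..real k} \<inter> X)" if "X \<in> sets borel" for k X
    unfolding M_def using that N by (subst emeasure_density) (auto simp: nn_integral_indicator[symmetric] indicator_inter_arith intro!: nn_integral_cong)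
  define B where "B k n = {t \<in> A. \<forall>d>0. \<exists>a b. a < b \<and> t \<in> {a..b} \<and> b - a < d \<and>
           ennreal (inverse (real (Suc n)) * (b - a)) < emeasure (M k) {a..b}}" for k n :: nat
  have "negligible (B k n)" for k n
    unfolding B_def
  proof (rule negligible_large_upper_density)
    show "sets (M k) = sets borel" by (simp add: M_def N)
    show "emeasure (M k) UNIV \<noteq> \<infinity>" using fin by (simp add: M)
    have "emeasure N ({-real k..real k} \<inter> A) \<le> emeasure N A"
      using A N by (intro emeasure_mono) auto
    then show "emeasure (M k) A = 0" using A by (simp add: M)
  qed (use A in auto)
  then have "AE t in lborel. \<forall>k n. t \<notin> B k n"
    unfolding AE_all_countable by (intro allI AE_lborel_not_in_negligible)
  then show ?thesis
  proof eventually_elim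
    case (elim t)
    show ?case
    proof (intro impI allI)
      fix e :: real assume "t \<in> A" "0 < e"
      obtain n where n: "inverse (real (Suc n)) < e" using reals_Archimedean[OF \<open>0 < e\<close>] by blast
      \<comment> \<open>The margin 1 keeps every interval of length below 1 containing
        \<open>t\<close> inside the window, where \<open>M k\<close> and \<open>N\<close>
        agree.\<close>
      obtain k where k: "\<bar>t\<bar> + 1 < real k" using reals_Archimedean2 by blast
      have "t \<notin> B k n" using elim by blast
      then obtain d where d: "0 < d" "\<And>a b. a < b \<Longrightarrow> t \<in> {a..b} \<Longrightarrow> b - a < d \<Longrightarrow>
         emeasure (M k) {a..b} \<le> ennreal (inverse (real (Suc n)) * (b - a))"
        using \<open>t \<in> A\<close> by (simp only: B_def mem_Collect_eq) (meson not_le)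
      show "\<exists>d>0. \<forall>a b. a < b \<and> t \<in> {a..b} \<and> b - a < d \<longrightarrow> emeasure N {a..b} \<le> ennreal (e * (b - a))"
      proof (intro exI[of _ "min d 1"] conjI allI impI)
        fix a b assume ab: "a < b \<and> t \<in> {a..b} \<and> b - a < min d 1"
        then have "{-real k..real k} \<inter> {a..b} = {a..b}" using k by auto
        then have "emeasure N {a..b} = emeasure (M k) {a..b}" by (simp only: M borel_closed closed_atLeastAtMost)
        also have "\<dots> \<le> ennreal (inverse (real (Suc n)) * (b - a))" using d(2)[of a b] ab by simp
        also have "\<dots> \<le> ennreal (e * (b - a))" using n ab by (intro ennreal_leI mult_right_mono) auto
        finally show "emeasure N {a..b} \<le> ennreal (e * (b - a))" .
      qed (use d in auto)
    qed
  qed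
qed

section \<open>Lebesgue points on the line\<close>

lemma set_integrable_const_Icc: "set_integrable lborel {a..b} (\<lambda>x::real. c::real)"
  by (simp add: set_integrable_def integrable_indicator_iff emeasure_lborel_Icc_eq)

lemma set_integral_const_Icc: "a \<le> b \<Longrightarrow> (LINT x:{a..b}|lborel. c) = c * (b - a)" for c :: real
  by (simp add: set_lebesgue_integral_def)

text \<open>Since \<open>ennreal\<close> sends negative numbers to 0, \<open>N q\<close> has density
  \<open>max 0 (w - q)\<close> and vanishes on the set where \<open>w \<le> q\<close>. At almost
  every point of that set small intervals carry little \<open>N q\<close>-mass, which bounds the
  averages of \<open>w\<close> by roughly \<open>q\<close>; a rational \<open>q\<close> slightly
  above \<open>w t\<close> finishes.\<close>

lemma AE_average_le:
  fixes w :: "real \<Rightarrow> real"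
  assumes [measurable]: "w \<in> borel_measurable borel"
    and int: "\<And>a b. set_integrable lborel {a..b} w"
  shows "AE t in lborel. \<forall>e>0. \<exists>d>0. \<forall>a b. a < b \<and> t \<in> {a..b} \<and> b - a < d \<longrightarrow>
           (LINT x:{a..b}|lborel. w x) \<le> (w t + e) * (b - a)"
proof -
  define N where "N q = density lborel (\<lambda>x. ennreal (w x - of_rat q))" for q
  have Nem: "emeasure (N q) X = (\<integral>\<^sup>+x. ennreal (indicator X x * (w x - of_rat q)) \<partial>lborel)"
    if "X \<in> sets borel" for q X
    unfolding N_def using that
    by (subst emeasure_density) (auto intro!: nn_integral_cong simp: indicator_def)
  have int': "set_integrable lborel {a..b} (\<lambda>x. w x - of_rat q)" for a b q
    by (intro set_integral_diff int set_integrable_const_Icc)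
  have "AE t in lborel. t \<in> {x. w x \<le> of_rat q} \<longrightarrow> (\<forall>e>0. \<exists>d>0. \<forall>a b. a < b \<and> t \<in> {a..b} \<and> b - a < d \<longrightarrow>
           emeasure (N q) {a..b} \<le> ennreal (e * (b - a)))" for q
  proof (rule AE_null_set_density_zero)
    show "emeasure (N q) {a..b} \<noteq> \<infinity>" for a b
    proof -
      have "(\<integral>\<^sup>+x. ennreal (indicator {a..b} x * (w x - of_rat q)) \<partial>lborel)
          \<le> (\<integral>\<^sup>+x. ennreal (norm (indicator {a..b} x * (w x - of_rat q))) \<partial>lborel)"
        by (intro nn_integral_mono ennreal_leI) simp
      also have "\<dots> < \<infinity>"
        using int'[of a b q] by (simp add: set_integrable_def integrable_iff_bounded)
      finally show ?thesis by (simp add: Nem)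
    qed
    have "emeasure (N q) {x. w x \<le> of_rat q} = (\<integral>\<^sup>+x. 0 \<partial>(lborel :: real measure))"
      by (subst Nem) (auto intro!: nn_integral_cong simp: indicator_def ennreal_neg)
    then show "emeasure (N q) {x. w x \<le> of_rat q} = 0" by simp
  qed (auto simp: N_def)
  then have "AE t in lborel. \<forall>q. t \<in> {x. w x \<le> of_rat q} \<longrightarrow> (\<forall>e>0. \<exists>d>0. \<forall>a b. a < b \<and> t \<in> {a..b} \<and> b - a < d \<longrightarrow>
           emeasure (N q) {a..b} \<le> ennreal (e * (b - a)))"
    unfolding AE_all_countable by blast
  then show ?thesis
  proof eventually_elim
    case (elim t)
    show ?case
    proof (intro allI impI)
      fix e :: real assume "0 < e"
      then obtain q where q: "w t < of_rat q" "of_rat q < w t + e/2"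
        using of_rat_dense[of "w t" "w t + e/2"] by auto
      from q have "t \<in> {x. w x \<le> of_rat q}" by simp
      moreover from \<open>0 < e\<close> have "0 < e/2" by simp
      ultimately obtain d where d: "0 < d" "\<And>a b. a < b \<Longrightarrow> t \<in> {a..b} \<Longrightarrow> b - a < d \<Longrightarrow>
           emeasure (N q) {a..b} \<le> ennreal (e/2 * (b - a))"
        using elim by meson
      have "(LINT x:{a..b}|lborel. w x) \<le> (w t + e) * (b - a)" if ab: "a < b" "t \<in> {a..b}" "b - a < d" for a b
      proof -
        have "(LINT x:{a..b}|lborel. (w x - of_rat q)) \<le> e/2 * (b - a)"
          using d(2)[OF ab] ab \<open>0 < e\<close> unfolding set_lebesgue_integral_def
          by (intro integral_real_bounded) (simp_all add: Nem)
        moreover have "(LINT x:{a..b}|lborel. (w x - of_rat q)) = (LINT x:{a..b}|lborel. w x) - of_rat q * (b - a)"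
          using ab by (subst set_integral_diff(2)) (auto simp: int set_integrable_const_Icc set_integral_const_Icc)
        moreover have "of_rat q * (b - a) \<le> (w t + e/2) * (b - a)"
          using q ab by (intro mult_right_mono) auto
        moreover have "(w t + e) * (b - a) = (w t + e/2) * (b - a) + e/2 * (b - a)"
          by (simp add: field_simps)
        ultimately show ?thesis by linarith
      qed
      with d(1) show "\<exists>d>0. \<forall>a b. a < b \<and> t \<in> {a..b} \<and> b - a < d \<longrightarrow>
           (LINT x:{a..b}|lborel. w x) \<le> (w t + e) * (b - a)" by blast
    qed
  qed
qed

text \<open>The one-sided estimate is used for \<open>w\<close> and for \<open>- w\<close>. The
  intervals may have \<open>t\<close> as an endpoint, as difference quotients at \<open>t\<close>
  require.\<close>

lemma Lebesgue_differentiation_real: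
  fixes w :: "real \<Rightarrow> real"
  assumes [measurable]: "w \<in> borel_measurable borel"
    and int: "\<And>a b. set_integrable lborel {a..b} w"
  shows "AE t in lborel. \<forall>e>0. \<exists>d>0. \<forall>a b. a < b \<and> t \<in> {a..b} \<and> b - a < d \<longrightarrow>
           \<bar>(LINT x:{a..b}|lborel. w x) - w t * (b - a)\<bar> \<le> e * (b - a)"
proof -
  have int': "set_integrable lborel {a..b} (\<lambda>x. - w x)" for a b
    using int[of a b] by (simp add: set_integrable_def)
  have neg: "(LINT x:{a..b}|lborel. - w x) = - (LINT x:{a..b}|lborel. w x)" for a b
    by (simp add: set_lebesgue_integral_def)
  have "AE t in lborel. \<forall>e>0. \<exists>d>0. \<forall>a b. a < b \<and> t \<in> {a..b} \<and> b - a < d \<longrightarrow>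
           (LINT x:{a..b}|lborel. w x) \<le> (w t + e) * (b - a)"
    by (rule AE_average_le[OF assms])
  moreover have "AE t in lborel. \<forall>e>0. \<exists>d>0. \<forall>a b. a < b \<and> t \<in> {a..b} \<and> b - a < d \<longrightarrow>
           (LINT x:{a..b}|lborel. - w x) \<le> (- w t + e) * (b - a)"
    by (rule AE_average_le[OF _ int']) simp
  ultimately show ?thesis
  proof eventually_elim
    case (elim t)
    show ?case
    proof (intro allI impI)
      fix e :: real assume "0 < e"
      obtain d1 where d1: "d1 > 0" "\<And>a b. a < b \<Longrightarrow> t \<in> {a..b} \<Longrightarrow> b - a < d1 \<Longrightarrow>
          (LINT x:{a..b}|lborel. w x) \<le> (w t + e) * (b - a)" using elim(1) \<open>0 < e\<close> by meson
      obtain d2 where d2: "d2 > 0" "\<And>a b. a < b \<Longrightarrow> t \<in> {a..b} \<Longrightarrow> b - a < d2 \<Longrightarrow>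
          (LINT x:{a..b}|lborel. - w x) \<le> (- w t + e) * (b - a)" using elim(2) \<open>0 < e\<close> by meson
      show "\<exists>d>0. \<forall>a b. a < b \<and> t \<in> {a..b} \<and> b - a < d \<longrightarrow>
           \<bar>(LINT x:{a..b}|lborel. w x) - w t * (b - a)\<bar> \<le> e * (b - a)"
      proof (intro exI[of _ "min d1 d2"] conjI allI impI)
        fix a b assume ab: "a < b \<and> t \<in> {a..b} \<and> b - a < min d1 d2"
        then show "\<bar>(LINT x:{a..b}|lborel. w x) - w t * (b - a)\<bar> \<le> e * (b - a)"
          using d1(2)[of a b] d2(2)[of a b] by (simp add: neg algebra_simps abs_le_iff)
      qed (use d1 d2 in auto)
    qed
  qed
qed

section \<open>Lipschitz functions on the line as integrals\<close>

text \<open>The density is the Radon-Nikodym derivative of the measure \<open>X \<mapsto> \<bar>g(X)\<bar>\<close>, which is absolutely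
  continuous because Lipschitz images of null sets are null.\<close>

lemma bi_Lipschitz_real_density:
  fixes g :: "real \<Rightarrow> real"
  assumes g_exp: "\<And>x y. x \<le> y \<Longrightarrow> y - x \<le> g y - g x"
    and g_lip: "\<And>x y. x \<le> y \<Longrightarrow> g y - g x \<le> M * (y - x)"
  shows "\<exists>w. w \<in> borel_measurable borel \<and> (\<forall>a b. set_integrable lborel {a..b} w) \<and>
    (\<forall>a b. a \<le> b \<longrightarrow> g b - g a = (LINT x:{a..b}|lborel. w x))"
proof -
  have abs_lip: "\<bar>g x - g y\<bar> \<le> M * \<bar>x - y\<bar>" for x y
    using g_exp[of x y] g_lip[of x y] g_exp[of y x] g_lip[of y x] by (cases "x \<le> y") auto
  have mono: "x \<le> y \<longleftrightarrow> g x \<le> g y" for x y using g_exp[of x y] g_exp[of y x] by fastforce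
  have inj: "inj g" by (intro injI) (metis mono order_antisym order_refl)
  have cont: "continuous_on UNIV g"
    using g_exp[of 0 1] g_lip[of 0 1] abs_lip
    by (intro lipschitz_on_continuous_on[of M] lipschitz_onI) (auto simp: dist_real_def)
  have "\<exists>x. g x = y" for y
  proof -
    define c where "c = \<bar>y - g 0\<bar>"
    have "g (- c) \<le> y" "y \<le> g c" using g_exp[of "-c" 0] g_exp[of 0 c] by (auto simp: c_def)
    then show ?thesis using IVT'[of g "-c" y c] cont continuous_on_subset by (force simp: c_def)
  qed
  then have surj: "surj g" by (metis surj_def)
  define k where "k = inv g"
  have gk [simp]: "g (k y) = y" "k (g x) = x" for x y
    using inj surj by (simp_all add: k_def surj_f_inv_f)
  \<comment> \<open>Because \<open>g\<close> does not shrink distances, its inverse is 1-Lipschitz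
    and hence Borel measurable.\<close>
  have "continuous_on UNIV k"
  proof (rule lipschitz_on_continuous_on[of 1])
    have "\<bar>k x - k y\<bar> \<le> \<bar>x - y\<bar>" for x y
      using g_exp[of "k x" "k y"] g_exp[of "k y" "k x"] by (cases "k x \<le> k y") auto
    then show "1-lipschitz_on UNIV k" by (auto intro!: lipschitz_onI simp: dist_real_def)
  qed
  then have [measurable]: "k \<in> borel_measurable borel" by (rule borel_measurable_continuous_onI)
  \<comment> \<open>Pushing Lebesgue measure forward along the inverse \<open>k\<close> measures
    images under \<open>g\<close>, which are preimages under \<open>k\<close> and therefore
    Borel.\<close>
  define N where "N = distr lborel borel k"
  have [simp]: "sets N = sets borel" by (simp add: N_def)
  have vim: "k -` X = g ` X" for X by (force simp: image_iff)
  have Nem: "emeasure N X = emeasure lborel (g ` X)" if "X \<in> sets borel" for X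
    unfolding N_def vim[symmetric] using that by (subst emeasure_distr) simp_all
  have NI: "emeasure N {a..b} = ennreal (g b - g a)" if "a \<le> b" for a b
  proof -
    have "g ` {a..b} = {g a..g b}"
      unfolding vim[symmetric] using mono[of a "k _"] mono[of "k _" b] by auto
    then show ?thesis using that mono[of a b] by (simp add: Nem)
  qed
  have "absolutely_continuous lborel N"
    unfolding absolutely_continuous_def
  proof
    fix X :: "real set" assume X: "X \<in> null_sets lborel"
    then have "negligible X" by (simp add: negligible_iff_null_sets null_sets_completionI)
    then have "negligible (g ` X)"
      by (rule negligible_locally_Lipschitz_image[OF order_refl])
         (use abs_lip in \<open>auto intro!: exI[of _ UNIV] exI[of _ M]\<close>)
    moreover have "g ` X \<in> sets borel"
      using X unfolding vim[symmetric] by (metis borel_measurable_vimage measurable_sets_borel null_setsD2 sets_lborel \<open>k \<in> borel_measurable borel\<close>)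
    ultimately have "emeasure lborel (g ` X) = 0"
      by (simp add: negligible_iff_null_sets null_sets_def)
    then show "X \<in> null_sets N" using X by (auto simp: null_sets_def Nem)
  qed
  then have dens: "density lborel (RN_deriv lborel N) = N"
    by (intro sigma_finite_measure.density_RN_deriv[OF sigma_finite_lborel]) auto
  \<comment> \<open>\<open>enn2real\<close> turns an infinite value into 0; sigma-finiteness of
    \<open>N\<close> confines such values to a null set.\<close>
  define w where "w x = enn2real (RN_deriv lborel N x)" for x
  have [measurable]: "w \<in> borel_measurable borel"
    using borel_measurable_RN_deriv[of lborel N] unfolding w_def[abs_def] by measurable
  have "AE x in lborel. RN_deriv lborel N x \<noteq> \<infinity>"
  proof (rule sigma_finite_measure.RN_deriv_finite[OF sigma_finite_lborel])
    show "sigma_finite_measure N"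
    proof (unfold_locales, intro exI[of _ "range (\<lambda>n::nat. {-real n..real n})"] conjI)
      show "\<Union> (range (\<lambda>n::nat. {-real n..real n})) = space N"
      proof -
        have "\<exists>n. x \<in> {-real n..real n}" for x :: real
          using real_arch_simple[of "\<bar>x\<bar>"] by (metis abs_le_iff atLeastAtMost_iff minus_le_iff)
        then show ?thesis by (auto simp: N_def)
      qed
    qed (auto simp: NI)
  qed (use \<open>absolutely_continuous lborel N\<close> in auto)
  then have fin: "AE x in lborel. RN_deriv lborel N x = ennreal (w x)"
    by eventually_elim (simp add: w_def less_top)
  have w: "(\<integral>\<^sup>+x. ennreal (indicator {a..b} x * w x) \<partial>lborel) = ennreal (g b - g a)" if "a \<le> b" for a b
  proof -
    have "(\<integral>\<^sup>+x. ennreal (indicator {a..b} x * w x) \<partial>lborel) = (\<integral>\<^sup>+x. RN_deriv lborel N x * indicator {a..b} x \<partial>lborel)"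
      using fin by (intro nn_integral_cong_AE) (auto elim!: eventually_mono simp: indicator_def)
    also have "\<dots> = emeasure N {a..b}"
      by (subst (2) dens[symmetric]) (simp add: emeasure_density)
    finally show ?thesis using NI that by simp
  qed
  have w0: "0 \<le> w x" for x by (simp add: w_def)
  have int: "set_integrable lborel {a..b} w" for a b
  proof (cases "a \<le> b")
    case True
    then show ?thesis using w[OF True] w0
      by (simp add: set_integrable_def integrable_iff_bounded)
  qed (simp add: set_integrable_def)
  have "(LINT x:{a..b}|lborel. w x) = g b - g a" if "a \<le> b" for a b
    using w[OF that] w0 that mono[of a b] unfolding set_lebesgue_integral_def
    by (subst integral_eq_nn_integral) auto
  then show ?thesis using int by (intro exI[of _ w]) auto
qed

text \<open>Adding \<open>(L + 1) * x\<close> raises all slopes to at least 1, which reduces the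
  claim to the bi-Lipschitz case; \<open>L + 1\<close> is then subtracted from the density.\<close>

lemma Lipschitz_real_integral_representation:
  fixes h :: "real \<Rightarrow> real"
  assumes h: "\<And>x y. \<bar>h x - h y\<bar> \<le> L * \<bar>x - y\<bar>"
  shows "\<exists>w. w \<in> borel_measurable borel \<and> (\<forall>a b. set_integrable lborel {a..b} w) \<and>
    (\<forall>a b. a \<le> b \<longrightarrow> h b - h a = (LINT x:{a..b}|lborel. w x))"
proof -
  define g where "g x = h x + (L + 1) * x" for x
  have "y - x \<le> g y - g x \<and> g y - g x \<le> (2 * L + 1) * (y - x)" if "x \<le> y" for x y
    using h[of x y] that by (auto simp: g_def set_integral_const_Icc algebra_simps abs_le_iff)
  then obtain w where [measurable]: "w \<in> borel_measurable borel"
    and w: "\<And>a b. set_integrable lborel {a..b} w" "\<And>a b. a \<le> b \<Longrightarrow> g b - g a = (LINT x:{a..b}|lborel. w x)"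
    using bi_Lipschitz_real_density[of g "2 * L + 1"] by blast
  note c = set_integrable_const_Icc
  have "h b - h a = (LINT x:{a..b}|lborel. w x - (L + 1))" if "a \<le> b" for a b
    using w(2)[OF that] that
    by (subst set_integral_diff(2)[OF w(1) c]) (simp add: g_def set_integral_const_Icc algebra_simps)
  then show ?thesis
    using set_integral_diff(1)[OF w(1) c] by (intro exI[of _ "\<lambda>x. w x - (L + 1)"]) auto
qed

section \<open>Sequences of Lipschitz functions on the line\<close>

text \<open>The second conjunct says without suprema that a single \<open>h\<^sub>i\<close> almost realises
  \<open>sup\<^sub>j \<bar>h\<^sub>j(s) - h\<^sub>j(t)\<bar>\<close> near \<open>t\<close>; in this form it defines a Borel set of points.\<close>

lemma Lipschitz_sequence_AE_real:
  fixes h :: "nat \<Rightarrow> real \<Rightarrow> real"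
  assumes h: "\<And>j x y. \<bar>h j x - h j y\<bar> \<le> L * \<bar>x - y\<bar>"
  shows "AE t in lborel.
     (\<forall>j. \<exists>c. \<forall>e>0. \<exists>d>0. \<forall>s. \<bar>s - t\<bar> < d \<longrightarrow> \<bar>h j s - h j t - c * (s - t)\<bar> \<le> e * \<bar>s - t\<bar>) \<and>
     (\<forall>e>0. \<exists>d>0. \<exists>i. \<forall>s. \<bar>s - t\<bar> < d \<longrightarrow> (\<forall>j. \<bar>h j s - h j t\<bar> \<le> \<bar>h i s - h i t\<bar> + e * \<bar>s - t\<bar>))"
proof -
  have L0: "0 \<le> L" using h[of 0 1 0] by simp
  have "\<exists>w. \<forall>j. w j \<in> borel_measurable borel \<and> (\<forall>a b. set_integrable lborel {a..b} (w j)) \<and>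
    (\<forall>a b. a \<le> b \<longrightarrow> h j b - h j a = (LINT x:{a..b}|lborel. w j x))"
    by (intro choice allI Lipschitz_real_integral_representation[OF h])
  then obtain w where wm[measurable]: "\<And>j. w j \<in> borel_measurable borel"
    and wint: "\<And>j a b. set_integrable lborel {a..b} (w j)"
    and wrep: "\<And>j a b. a \<le> b \<Longrightarrow> h j b - h j a = (LINT x:{a..b}|lborel. w j x)"
    by blast
  have LD: "AE t in lborel. \<forall>j. \<forall>e>0. \<exists>d>0. \<forall>a b. a < b \<and> t \<in> {a..b} \<and> b - a < d \<longrightarrow>
           \<bar>(LINT x:{a..b}|lborel. w j x) - w j t * (b - a)\<bar> \<le> e * (b - a)"
    unfolding AE_all_countable by (intro allI Lebesgue_differentiation_real wm wint)
  have der: "AE t in lborel. \<forall>j. \<forall>e>0. \<exists>d>0. \<forall>s. \<bar>s - t\<bar> < d \<longrightarrow> \<bar>h j s - h j t - w j t * (s - t)\<bar> \<le> e * \<bar>s - t\<bar>"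
    using LD
  proof eventually_elim
    case (elim t)
    show ?case
    proof (intro allI impI)
      fix j and e :: real assume "0 < e"
      with elim obtain d where d: "d > 0" "\<And>a b. a < b \<Longrightarrow> t \<in> {a..b} \<Longrightarrow> b - a < d \<Longrightarrow>
           \<bar>(LINT x:{a..b}|lborel. w j x) - w j t * (b - a)\<bar> \<le> e * (b - a)" by meson
      have "\<bar>h j s - h j t - w j t * (s - t)\<bar> \<le> e * \<bar>s - t\<bar>" if "\<bar>s - t\<bar> < d" for s
      proof (cases s t rule: linorder_cases)
        case less
        then have "\<bar>(h j t - h j s) - w j t * (t - s)\<bar> \<le> e * (t - s)"
          using d(2)[of s t] that wrep[of s t j] by simp
        moreover have "(h j t - h j s) - w j t * (t - s) = - (h j s - h j t - w j t * (s - t))"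
          by (simp add: algebra_simps)
        ultimately show ?thesis using less by (simp only: abs_minus_cancel) simp
      next
        case greater
        then show ?thesis using d(2)[of t s] that wrep[of t s j] by simp
      qed simp
      with d(1) show "\<exists>d>0. \<forall>s. \<bar>s - t\<bar> < d \<longrightarrow> \<bar>h j s - h j t - w j t * (s - t)\<bar> \<le> e * \<bar>s - t\<bar>" by blast
    qed
  qed
  \<comment> \<open>A density is determined only almost everywhere, so its bound is read off from
    the difference quotients of \<open>h j\<close>.\<close>
  have wL: "AE t in lborel. \<forall>j. \<bar>w j t\<bar> \<le> L"
    using der
  proof eventually_elim
    case (elim t)
    show ?case
    proof (rule allI, rule field_le_epsilon)
      fix j and e :: real assume "0 < e"
      obtain d where d: "d > 0" "\<And>s. \<bar>s - t\<bar> < d \<Longrightarrow> \<bar>h j s - h j t - w j t * (s - t)\<bar> \<le> e * \<bar>s - t\<bar>"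
        using elim[THEN spec, THEN spec, THEN mp, OF \<open>0 < e\<close>, of j] by blast
      have "\<bar>h j (t + d/2) - h j t - w j t * (d/2)\<bar> \<le> e * (d/2)" using d(2)[of "t + d/2"] d(1) by simp
      moreover have "\<bar>h j (t + d/2) - h j t\<bar> \<le> L * (d/2)" using h[of j "t + d/2" t] d(1) by simp
      ultimately have "\<bar>w j t * (d/2)\<bar> \<le> (L + e) * (d/2)" unfolding distrib_right by linarith
      then have "\<bar>w j t\<bar> * (d/2) \<le> (L + e) * (d/2)" using d(1) by (simp add: abs_mult)
      then show "\<bar>w j t\<bar> \<le> L + e" using d(1) by simp
    qed
  qed
  \<comment> \<open>Cutting off at \<open>L\<close> changes the functions only on a null set, and
    makes the supremum \<open>m\<close> finite and bounded at every point.\<close>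
  define v where "v j x = min L \<bar>w j x\<bar>" for j x
  have v: "0 \<le> v j x" "v j x \<le> L" for j x using L0 by (auto simp: v_def)
  have [measurable]: "v j \<in> borel_measurable borel" for j
    unfolding v_def[abs_def] by measurable
  define m where "m x = (SUP j. v j x)" for x
  have bdd: "bdd_above (range (\<lambda>j. v j x))" for x using v by (intro bdd_aboveI[of _ L]) auto
  have mm [measurable]: "m \<in> borel_measurable borel"
    unfolding m_def[abs_def] by (intro borel_measurable_cSUP bdd) auto
  have vm: "v j x \<le> m x" for j x unfolding m_def using bdd by (intro cSUP_upper) auto
  have m: "0 \<le> m x" "m x \<le> L" for x
    using v(1)[of 0 x] vm[of 0 x] v(2) by (auto simp: m_def intro!: cSUP_least)
  have mint: "set_integrable lborel {a..b} m" for a b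
    by (rule set_integrable_bound[OF set_integrable_const_Icc[of a b L]])
       (use m in \<open>auto simp: set_borel_measurable_def abs_of_nonneg L0\<close>)
  have hm: "\<bar>h j b - h j a\<bar> \<le> (LINT x:{a..b}|lborel. m x)" if "a \<le> b" for a b j
  proof -
    have "\<bar>h j b - h j a\<bar> \<le> (LINT x|lborel. \<bar>indicator {a..b} x *\<^sub>R w j x\<bar>)"
      unfolding wrep[OF that] set_lebesgue_integral_def by (rule integral_abs_bound)
    also have "\<dots> \<le> (LINT x|lborel. indicator {a..b} x *\<^sub>R m x)"
    proof (rule integral_mono_AE)
      show "integrable lborel (\<lambda>x. \<bar>indicator {a..b} x *\<^sub>R w j x\<bar>)"
        using wint[of a b j] unfolding set_integrable_def by (rule integrable_abs)
      show "integrable lborel (\<lambda>x. indicator {a..b} x *\<^sub>R m x)"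
        using mint[of a b] unfolding set_integrable_def .
      show "AE x in lborel. \<bar>indicator {a..b} x *\<^sub>R w j x\<bar> \<le> indicator {a..b} x *\<^sub>R m x"
        using wL
      proof eventually_elim
        case (elim x)
        then have "\<bar>w j x\<bar> \<le> m x" using vm[of j x] by (simp add: v_def min_absorb2)
        then show ?case by (simp add: indicator_def)
      qed
    qed
    finally show ?thesis unfolding set_lebesgue_integral_def .
  qed
  have "AE t in lborel. \<forall>e>0. \<exists>d>0. \<forall>a b. a < b \<and> t \<in> {a..b} \<and> b - a < d \<longrightarrow>
           \<bar>(LINT x:{a..b}|lborel. m x) - m t * (b - a)\<bar> \<le> e * (b - a)"
    by (intro Lebesgue_differentiation_real mm mint)
  then have "AE t in lborel. \<forall>e>0. \<exists>d>0. \<forall>s. \<bar>s - t\<bar> < d \<longrightarrow> (\<forall>j. \<bar>h j s - h j t\<bar> \<le> (m t + e) * \<bar>s - t\<bar>)"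
  proof eventually_elim
    case (elim t)
    show ?case
    proof (intro allI impI)
      fix e :: real assume "0 < e"
      with elim obtain d where d: "d > 0" "\<And>a b. a < b \<Longrightarrow> t \<in> {a..b} \<Longrightarrow> b - a < d \<Longrightarrow>
           \<bar>(LINT x:{a..b}|lborel. m x) - m t * (b - a)\<bar> \<le> e * (b - a)" by meson
      have "\<bar>h j s - h j t\<bar> \<le> (m t + e) * \<bar>s - t\<bar>" if "\<bar>s - t\<bar> < d" for s j
      proof (cases s t rule: linorder_cases)
        case less
        then have "\<bar>(LINT x:{s..t}|lborel. m x) - m t * (t - s)\<bar> \<le> e * (t - s)" using d(2)[of s t] that by simp
        then have "\<bar>h j t - h j s\<bar> \<le> (m t + e) * (t - s)"
          using hm[of s t j] less unfolding distrib_right by linarith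
        then show ?thesis using less by (simp add: abs_minus_commute)
      next
        case greater
        then have "\<bar>(LINT x:{t..s}|lborel. m x) - m t * (s - t)\<bar> \<le> e * (s - t)" using d(2)[of t s] that by simp
        then have "\<bar>h j s - h j t\<bar> \<le> (m t + e) * (s - t)"
          using hm[of t s j] greater unfolding distrib_right by linarith
        then show ?thesis using greater by simp
      qed simp
      with d(1) show "\<exists>d>0. \<forall>s. \<bar>s - t\<bar> < d \<longrightarrow> (\<forall>j. \<bar>h j s - h j t\<bar> \<le> (m t + e) * \<bar>s - t\<bar>)" by blast
    qed
  qed
  with der wL show ?thesis
  proof eventually_elim
    case (elim t)
    have "\<exists>d>0. \<exists>i. \<forall>s. \<bar>s - t\<bar> < d \<longrightarrow> (\<forall>j. \<bar>h j s - h j t\<bar> \<le> \<bar>h i s - h i t\<bar> + e * \<bar>s - t\<bar>)"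
      if "0 < e" for e
    proof -
      from \<open>0 < e\<close> have "0 < e/3" by simp
      \<comment> \<open>The index \<open>i\<close> nearly attains \<open>m t\<close>. One third of
        \<open>e\<close> goes to this choice, one to the bound of the increments by
        \<open>m\<close>, one to the linearisation of \<open>h i\<close>.\<close>
      have "m t - e/3 < m t" using \<open>0 < e\<close> by simp
      then obtain i where "m t - e/3 < v i t"
        unfolding m_def using less_cSUP_iff[OF _ bdd] by auto
      then have i: "m t - e/3 < \<bar>w i t\<bar>" using elim by (simp add: v_def)
      obtain d1 where d1: "d1 > 0" "\<And>s. \<bar>s - t\<bar> < d1 \<Longrightarrow> \<bar>h i s - h i t - w i t * (s - t)\<bar> \<le> e/3 * \<bar>s - t\<bar>"
        using elim(1)[THEN spec, THEN spec, THEN mp, OF \<open>0 < e/3\<close>, of i] by blast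
      obtain d2 where d2: "d2 > 0" "\<And>s j. \<bar>s - t\<bar> < d2 \<Longrightarrow> \<bar>h j s - h j t\<bar> \<le> (m t + e/3) * \<bar>s - t\<bar>"
        using elim(3)[THEN spec, THEN mp, OF \<open>0 < e/3\<close>] by blast
      have "\<bar>h j s - h j t\<bar> \<le> \<bar>h i s - h i t\<bar> + e * \<bar>s - t\<bar>" if s: "\<bar>s - t\<bar> < min d1 d2" for s j
      proof -
        have "\<bar>h j s - h j t\<bar> \<le> (m t + e/3) * \<bar>s - t\<bar>" using d2(2) s by simp
        also have "\<dots> \<le> (\<bar>w i t\<bar> + e/3 + e/3) * \<bar>s - t\<bar>" using i by (intro mult_right_mono) auto
        also have "\<dots> = \<bar>w i t * (s - t)\<bar> + e/3 * \<bar>s - t\<bar> + e/3 * \<bar>s - t\<bar>" by (simp add: distrib_right abs_mult)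
        also have "\<bar>w i t * (s - t)\<bar> \<le> \<bar>h i s - h i t\<bar> + e/3 * \<bar>s - t\<bar>" using d1(2)[of s] s by linarith
        finally show ?thesis by simp
      qed
      then show ?thesis using d1(1) d2(1) by (intro exI[of _ "min d1 d2"]) auto
    qed
    with elim(1) show ?case by blast
  qed
qed

section \<open>Directional derivatives\<close>

lemma AE_not_in_if_slices_null:
  fixes E :: "'a::euclidean_space set"
  assumes E: "E \<in> sets borel" and slice: "\<And>x. AE t in lborel. x + t *\<^sub>R v \<notin> E"
  shows "AE x in lborel. x \<notin> E"
proof -
  note [measurable] = E
  \<comment> \<open>Integrating over \<open>t \<in> [0,1]\<close> the measures of the translates of \<open>E\<close> by \<open>t v\<close> gives the measure of
    \<open>E\<close>; in the other order of integration the slices give 0.\<close>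
  have P: "pair_sigma_finite (lborel :: 'a measure) (lborel :: real measure)"
    by (intro pair_sigma_finite.intro sigma_finite_lborel)
  let ?f = "\<lambda>x t. indicator {0..1} t * indicator E (x + t *\<^sub>R v) :: ennreal"
  have "(\<integral>\<^sup>+x. indicator E (x + t *\<^sub>R v) \<partial>lborel) = emeasure lborel E" for t
  proof -
    have "emeasure lborel E = (\<integral>\<^sup>+x. indicator E x \<partial>distr lborel borel ((+) (t *\<^sub>R v)))"
      by (simp add: lborel_distr_plus)
    also have "\<dots> = (\<integral>\<^sup>+x. indicator E (t *\<^sub>R v + x) \<partial>lborel)"
      by (subst nn_integral_distr) auto
    finally show ?thesis by (simp add: add.commute)
  qed
  then have "(\<integral>\<^sup>+t. (\<integral>\<^sup>+x. ?f x t \<partial>lborel) \<partial>lborel) = (\<integral>\<^sup>+t. emeasure lborel E * indicator {0..1::real} t \<partial>lborel)"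
    by (intro nn_integral_cong) (simp add: nn_integral_cmult mult.commute)
  also have "\<dots> = emeasure lborel E"
    by (subst nn_integral_cmult_indicator) auto
  finally have "emeasure lborel E = (\<integral>\<^sup>+t. (\<integral>\<^sup>+x. ?f x t \<partial>lborel) \<partial>lborel)" ..
  also have "\<dots> = (\<integral>\<^sup>+x. (\<integral>\<^sup>+t. ?f x t \<partial>lborel) \<partial>lborel)"
    by (rule pair_sigma_finite.Fubini'[OF P]) (simp add: case_prod_unfold)
  also have "\<dots> = (\<integral>\<^sup>+x. 0 \<partial>(lborel :: 'a measure))"
  proof (rule nn_integral_cong)
    fix x
    have "(\<integral>\<^sup>+t. ?f x t \<partial>lborel) = (\<integral>\<^sup>+t. 0 \<partial>(lborel :: real measure))"
      using slice[of x] by (intro nn_integral_cong_AE) (auto elim!: eventually_mono)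
    then show "(\<integral>\<^sup>+t. ?f x t \<partial>lborel) = 0" by simp
  qed
  finally show ?thesis
    using E by (intro AE_not_in) (auto simp: null_sets_def)
qed

text \<open>The two-sided derivative along the line, written without division: for fixed
  \<open>e\<close>, \<open>d\<close>, \<open>c\<close> and continuous \<open>h\<close> the
  inequality describes a closed set of points \<open>x\<close>, so the exceptional sets become
  Borel.\<close>

definition dir_deriv :: "('a::real_normed_vector \<Rightarrow> real) \<Rightarrow> 'a \<Rightarrow> 'a \<Rightarrow> real \<Rightarrow> bool" where
  "dir_deriv h x v c \<longleftrightarrow>
     (\<forall>e>0. \<exists>d>0. \<forall>t. \<bar>t\<bar> < d \<longrightarrow> \<bar>h (x + t *\<^sub>R v) - h x - c * t\<bar> \<le> e * \<bar>t\<bar>)"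

lemma dir_derivD:
  assumes "dir_deriv h x v c" "0 < e"
  obtains d where "0 < d" "\<And>t. \<bar>t\<bar> < d \<Longrightarrow> \<bar>h (x + t *\<^sub>R v) - h x - c * t\<bar> \<le> e * \<bar>t\<bar>"
  using assms unfolding dir_deriv_def by blast

lemma dir_deriv_scaleR:
  assumes "dir_deriv h x v c"
  shows "dir_deriv h x (r *\<^sub>R v) (r * c)"
  unfolding dir_deriv_def
proof (intro allI impI)
  fix e :: real assume "0 < e"
  \<comment> \<open>The added 1 keeps \<open>R\<close> positive when \<open>r = 0\<close>.\<close>
  define R where "R = \<bar>r\<bar> + 1"
  have R: "0 < R" "\<bar>r\<bar> \<le> R" by (auto simp: R_def)
  obtain d where d: "0 < d" "\<And>t. \<bar>t\<bar> < d \<Longrightarrow> \<bar>h (x + t *\<^sub>R v) - h x - c * t\<bar> \<le> e / R * \<bar>t\<bar>"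
    using dir_derivD[OF assms, of "e / R"] \<open>0 < e\<close> R by auto
  have "\<bar>h (x + t *\<^sub>R r *\<^sub>R v) - h x - r * c * t\<bar> \<le> e * \<bar>t\<bar>" if t: "\<bar>t\<bar> < d / R" for t
  proof -
    have *: "\<bar>t * r\<bar> \<le> \<bar>t\<bar> * R" unfolding abs_mult using R by (intro mult_left_mono) auto
    also have "\<dots> < d" using t R by (simp add: field_simps)
    finally have "\<bar>h (x + (t * r) *\<^sub>R v) - h x - c * (t * r)\<bar> \<le> e / R * \<bar>t * r\<bar>" by (rule d(2))
    also have "\<dots> \<le> e / R * (\<bar>t\<bar> * R)" using * R \<open>0 < e\<close> by (intro mult_left_mono) auto
    also have "\<dots> = e * \<bar>t\<bar>" using R by simp
    finally show ?thesis by (simp add: mult.commute mult.left_commute)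
  qed
  then show "\<exists>d>0. \<forall>t. \<bar>t\<bar> < d \<longrightarrow> \<bar>h (x + t *\<^sub>R r *\<^sub>R v) - h x - r * c * t\<bar> \<le> e * \<bar>t\<bar>"
    using d(1) R by (intro exI[of _ "d / R"]) auto
qed

text \<open>Compared at a common \<open>t\<close>, two approximate slopes differ by at most the sum
  of their errors, so they form a Cauchy sequence, whose limit is the derivative. This recovers a
  derivative from countably many approximate conditions.\<close>

lemma real_derivative_from_approximations:
  fixes g :: "real \<Rightarrow> real"
  assumes "\<And>n::nat. \<exists>q d. 0 < d \<and> (\<forall>t. \<bar>t\<bar> < d \<longrightarrow> \<bar>g t - q * t\<bar> \<le> inverse (real (Suc n)) * \<bar>t\<bar>)"
  shows "\<exists>c. \<forall>e>0. \<exists>d>0. \<forall>t. \<bar>t\<bar> < d \<longrightarrow> \<bar>g t - c * t\<bar> \<le> e * \<bar>t\<bar>"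
proof -
  let ?e = "\<lambda>n. inverse (real (Suc n))"
  obtain q d where d: "\<And>n. 0 < d n" and q: "\<And>n t. \<bar>t\<bar> < d n \<Longrightarrow> \<bar>g t - q n * t\<bar> \<le> ?e n * \<bar>t\<bar>"
    using assms by metis
  have qq: "\<bar>q n - q k\<bar> \<le> ?e n + ?e k" for n k
  proof -
    define t where "t = min (d n) (d k) / 2"
    have t: "0 < t" "\<bar>t\<bar> < d n" "\<bar>t\<bar> < d k" using d[of n] d[of k] by (auto simp: t_def)
    have "\<bar>q n * t - q k * t\<bar> \<le> ?e n * t + ?e k * t"
      using q[OF t(2)] q[OF t(3)] t(1) by linarith
    then have "\<bar>q n - q k\<bar> * t \<le> (?e n + ?e k) * t"
      using t(1) by (simp add: distrib_right abs_mult flip: left_diff_distrib)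
    then show ?thesis using t(1) by simp
  qed
  have "Cauchy q"
  proof (rule metric_CauchyI)
    fix e :: real assume "0 < e"
    then obtain N where N: "?e N < e / 2" using reals_Archimedean[of "e/2"] by auto
    have "dist (q n) (q k) < e" if "N \<le> n" "N \<le> k" for n k
    proof -
      have "?e n \<le> ?e N" "?e k \<le> ?e N" using that by auto
      then show ?thesis using qq[of n k] N unfolding dist_real_def by linarith
    qed
    then show "\<exists>N. \<forall>m\<ge>N. \<forall>n\<ge>N. dist (q m) (q n) < e" by blast
  qed
  then obtain c where c: "q \<longlonglongrightarrow> c" using Cauchy_convergent convergent_def by blast
  have qc: "\<bar>q n - c\<bar> \<le> ?e n" for n
  proof -
    have "(\<lambda>k. \<bar>q n - q k\<bar>) \<longlonglongrightarrow> \<bar>q n - c\<bar>" by (intro tendsto_intros c)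
    moreover have "(\<lambda>k. ?e n + ?e k) \<longlonglongrightarrow> ?e n + 0"
      by (intro tendsto_intros LIMSEQ_inverse_real_of_nat)
    ultimately have "\<bar>q n - c\<bar> \<le> ?e n + 0" by (rule LIMSEQ_le) (use qq in blast)
    then show ?thesis by simp
  qed
  show ?thesis
  proof (rule exI[of _ c], intro allI impI)
    fix e :: real assume "0 < e"
    then obtain n where n: "?e n < e / 2" using reals_Archimedean[of "e/2"] by auto
    have "\<bar>g t - c * t\<bar> \<le> e * \<bar>t\<bar>" if "\<bar>t\<bar> < d n" for t
    proof -
      have "\<bar>g t - c * t\<bar> \<le> \<bar>g t - q n * t\<bar> + \<bar>(q n - c) * t\<bar>" by (simp add: left_diff_distrib)
      also have "\<dots> \<le> ?e n * \<bar>t\<bar> + ?e n * \<bar>t\<bar>"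
        unfolding abs_mult using q[OF that] qc[of n] by (intro add_mono mult_right_mono) auto
      also have "\<dots> = (2 * ?e n) * \<bar>t\<bar>" by simp
      also have "\<dots> \<le> e * \<bar>t\<bar>" using n by (intro mult_right_mono) auto
      finally show ?thesis .
    qed
    with d[of n] show "\<exists>d>0. \<forall>t. \<bar>t\<bar> < d \<longrightarrow> \<bar>g t - c * t\<bar> \<le> e * \<bar>t\<bar>" by blast
  qed
qed

lemma continuous_on_if_Lipschitz:
  fixes h :: "'a::real_normed_vector \<Rightarrow> real"
  assumes "\<And>x y. \<bar>h x - h y\<bar> \<le> L * norm (x - y)"
  shows "continuous_on UNIV h"
proof (rule lipschitz_on_continuous_on[of "\<bar>L\<bar>"], rule lipschitz_onI)
  fix x y
  have "\<bar>h x - h y\<bar> \<le> L * norm (x - y)" by (rule assms)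
  also have "\<dots> \<le> \<bar>L\<bar> * norm (x - y)" by (intro mult_right_mono) auto
  finally show "dist (h x) (h y) \<le> \<bar>L\<bar> * dist x y" by (simp add: dist_norm)
qed simp

lemma closed_approx_derivative:
  fixes h :: "'a::real_normed_vector \<Rightarrow> real"
  assumes "continuous_on UNIV h"
  shows "closed {x. \<forall>t. \<bar>t\<bar> < d \<longrightarrow> \<bar>h (x + t *\<^sub>R v) - h x - c * t\<bar> \<le> e * \<bar>t\<bar>}"
  by (intro closed_Collect_all closed_Collect_imp closed_Collect_le continuous_intros
      continuous_on_compose2[OF assms]) auto

text \<open>On lines parallel to \<open>v\<close> this is the one-dimensional result. Integrating
  over the lines requires a Borel set of good points, so both conditions are rewritten, with
  rational slopes and tolerances \<open>1 / (n + 1)\<close>, as countable unions and intersections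
  of closed sets.\<close>

lemma AE_directional:
  fixes h :: "nat \<Rightarrow> 'a::euclidean_space \<Rightarrow> real"
  assumes h: "\<And>j x y. \<bar>h j x - h j y\<bar> \<le> L * norm (x - y)"
  shows "AE x in lborel. (\<forall>j. \<exists>c. dir_deriv (h j) x v c) \<and>
     (\<forall>e>0. \<exists>d>0. \<exists>i. \<forall>t. \<bar>t\<bar> < d \<longrightarrow>
        (\<forall>j. \<bar>h j (x + t *\<^sub>R v) - h j x\<bar> \<le> \<bar>h i (x + t *\<^sub>R v) - h i x\<bar> + e * \<bar>t\<bar>))"
proof -
  let ?e = "\<lambda>n. inverse (real (Suc n))"
  note cont = continuous_on_if_Lipschitz[OF h]
  define A where "A j n k q = {x. \<forall>t. \<bar>t\<bar> < ?e k \<longrightarrow> \<bar>h j (x + t *\<^sub>R v) - h j x - real_of_rat q * t\<bar> \<le> ?e n * \<bar>t\<bar>}" for j n k q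
  define B where "B n k i = {x. \<forall>t. \<bar>t\<bar> < ?e k \<longrightarrow>
    (\<forall>j. \<bar>h j (x + t *\<^sub>R v) - h j x\<bar> \<le> \<bar>h i (x + t *\<^sub>R v) - h i x\<bar> + ?e n * \<bar>t\<bar>)}" for n k i
  define G where "G = (\<Inter>j n. \<Union>k q. A j n k q) \<inter> (\<Inter>n. \<Union>k i. B n k i)"
  have "closed (A j n k q)" for j n k q
    unfolding A_def by (rule closed_approx_derivative[OF cont])
  then have [measurable]: "A j n k q \<in> sets borel" for j n k q by (rule borel_closed)
  have "closed (B n k i)" for n k i
    unfolding B_def
    by (intro closed_Collect_all closed_Collect_imp closed_Collect_le continuous_intros
      continuous_on_compose2[OF cont]) auto
  then have [measurable]: "B n k i \<in> sets borel" for n k i by (rule borel_closed)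
  have "G \<in> sets borel" unfolding G_def by measurable
  have Ie: "\<exists>k. ?e k < d" if "0 < d" for d :: real using reals_Archimedean[OF that] by blast
  have "AE x in lborel. x \<notin> - G"
  proof (rule AE_not_in_if_slices_null[where v = v])
    show "- G \<in> sets borel" using \<open>G \<in> sets borel\<close> by auto
    fix x
    have "\<bar>h j (x + s *\<^sub>R v) - h j (x + t *\<^sub>R v)\<bar> \<le> (L * norm v) * \<bar>s - t\<bar>" for j s t
      using h[of j "x + s *\<^sub>R v" "x + t *\<^sub>R v"] by (simp add: mult_ac flip: scaleR_left_diff_distrib)
    from Lipschitz_sequence_AE_real[of "\<lambda>j s. h j (x + s *\<^sub>R v)", OF this]
    show "AE s in lborel. x + s *\<^sub>R v \<notin> - G"
    proof eventually_elim
      case (elim s)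
      let ?y = "x + s *\<^sub>R v"
      have sh: "x + (s + t) *\<^sub>R v = ?y + t *\<^sub>R v" for t by (simp add: algebra_simps)
      have "\<exists>k q. ?y \<in> A j n k q" for j n
      proof -
        obtain c where c: "\<forall>e>0. \<exists>d>0. \<forall>r. \<bar>r - s\<bar> < d \<longrightarrow> \<bar>h j (x + r *\<^sub>R v) - h j ?y - c * (r - s)\<bar> \<le> e * \<bar>r - s\<bar>"
          using elim by blast
        have "0 < ?e n / 2" by simp
        then obtain d where d: "d > 0" "\<And>r. \<bar>r - s\<bar> < d \<Longrightarrow> \<bar>h j (x + r *\<^sub>R v) - h j ?y - c * (r - s)\<bar> \<le> ?e n / 2 * \<bar>r - s\<bar>"
          using c[THEN spec, THEN mp] by blast
        obtain k where k: "?e k < d" using Ie[OF d(1)] by blast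
        \<comment> \<open>Replacing \<open>c\<close> by a rational slope uses the second half of the
          tolerance \<open>?e n\<close>.\<close>
        obtain q where q: "c - ?e n / 2 < of_rat q" "of_rat q < c"
          using of_rat_dense[of "c - ?e n / 2" c] by auto
        have "\<bar>h j (?y + t *\<^sub>R v) - h j ?y - real_of_rat q * t\<bar> \<le> ?e n * \<bar>t\<bar>" if "\<bar>t\<bar> < ?e k" for t
        proof -
          have "\<bar>h j (?y + t *\<^sub>R v) - h j ?y - c * t\<bar> \<le> ?e n / 2 * \<bar>t\<bar>"
            using d(2)[of "s + t"] that k by (simp add: sh)
          moreover have "\<bar>(c - of_rat q) * t\<bar> \<le> ?e n / 2 * \<bar>t\<bar>"
            unfolding abs_mult using q by (intro mult_right_mono) auto
          moreover have "(c - of_rat q) * t = c * t - of_rat q * t" by (rule left_diff_distrib)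
          ultimately show ?thesis by linarith
        qed
        then show ?thesis unfolding A_def by blast
      qed
      moreover have "\<exists>k i. ?y \<in> B n k i" for n
      proof -
        have "0 < ?e n" by simp
        then obtain d i where d: "d > 0" "\<And>r j. \<bar>r - s\<bar> < d \<Longrightarrow>
          \<bar>h j (x + r *\<^sub>R v) - h j ?y\<bar> \<le> \<bar>h i (x + r *\<^sub>R v) - h i ?y\<bar> + ?e n * \<bar>r - s\<bar>"
          using elim[THEN conjunct2, THEN spec, THEN mp] by blast
        obtain k where k: "?e k < d" using Ie[OF d(1)] by blast
        have "\<bar>h j (?y + t *\<^sub>R v) - h j ?y\<bar> \<le> \<bar>h i (?y + t *\<^sub>R v) - h i ?y\<bar> + ?e n * \<bar>t\<bar>" if "\<bar>t\<bar> < ?e k" for t j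
          using d(2)[of "s + t" j] that k by (simp add: sh)
        then show ?thesis unfolding B_def by blast
      qed
      ultimately show ?case by (simp add: G_def)
    qed
  qed
  then show ?thesis
  proof eventually_elim
    case (elim x)
    then have xA: "\<exists>k q. x \<in> A j n k q" and xB: "\<exists>k i. x \<in> B n k i" for j n
      by (simp_all add: G_def)
    have "\<exists>c. dir_deriv (h j) x v c" for j
      unfolding dir_deriv_def
    proof (rule real_derivative_from_approximations)
      fix n
      obtain k q where "x \<in> A j n k q" using xA by blast
      then show "\<exists>q d. 0 < d \<and> (\<forall>t. \<bar>t\<bar> < d \<longrightarrow> \<bar>h j (x + t *\<^sub>R v) - h j x - q * t\<bar> \<le> ?e n * \<bar>t\<bar>)"
        unfolding A_def by (intro exI[of _ "of_rat q"] exI[of _ "?e k"]) simp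
    qed
    moreover have "\<exists>d>0. \<exists>i. \<forall>t. \<bar>t\<bar> < d \<longrightarrow>
        (\<forall>j. \<bar>h j (x + t *\<^sub>R v) - h j x\<bar> \<le> \<bar>h i (x + t *\<^sub>R v) - h i x\<bar> + e * \<bar>t\<bar>)" if "0 < e" for e
    proof -
      obtain n where n: "?e n < e" using Ie[OF \<open>0 < e\<close>] by blast
      obtain k i where "x \<in> B n k i" using xB by blast
      then have B: "\<bar>h j (x + t *\<^sub>R v) - h j x\<bar> \<le> \<bar>h i (x + t *\<^sub>R v) - h i x\<bar> + ?e n * \<bar>t\<bar>"
        if "\<bar>t\<bar> < ?e k" for t j using that unfolding B_def by blast
      have "\<bar>h j (x + t *\<^sub>R v) - h j x\<bar> \<le> \<bar>h i (x + t *\<^sub>R v) - h i x\<bar> + e * \<bar>t\<bar>"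
        if "\<bar>t\<bar> < ?e k" for t j
        using B[OF that, of j] mult_right_mono[OF less_imp_le[OF n] abs_ge_zero[of t]] by linarith
      then show ?thesis by (intro exI[of _ "?e k"] exI[of _ i] conjI allI impI) simp_all
    qed
    ultimately show ?case by blast
  qed
qed

section \<open>Additivity and linearity of directional derivatives\<close>

text \<open>Two elements with the same value of \<open>\<lfloor>s / d\<rfloor>\<close> would be
  closer than \<open>d\<close>, so rounding embeds \<open>S\<close> into the integers.\<close>

lemma countable_if_separated:
  fixes S :: "real set"
  assumes "0 < d" and sep: "\<And>s t. s \<in> S \<Longrightarrow> t \<in> S \<Longrightarrow> s \<noteq> t \<Longrightarrow> d \<le> \<bar>s - t\<bar>"
  shows "countable S"
proof (rule countable_image_inj_on)
  show "countable ((\<lambda>s. \<lfloor>s / d\<rfloor>) ` S)" by simp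
  show "inj_on (\<lambda>s. \<lfloor>s / d\<rfloor>) S"
  proof (rule inj_onI, rule ccontr)
    fix s t assume st: "s \<in> S" "t \<in> S" "\<lfloor>s / d\<rfloor> = \<lfloor>t / d\<rfloor>" "s \<noteq> t"
    then have "\<bar>s / d - t / d\<bar> < 1" by linarith
    then have "\<bar>s - t\<bar> < d" using \<open>0 < d\<close> by (simp add: field_simps flip: diff_divide_distrib)
    then show False using sep[OF st(1,2,4)] by simp
  qed
qed

text \<open>A defect of additivity above \<open>6 * e\<close> survives the passage to rational
  slopes, which costs at most \<open>3 * e / 2\<close>.\<close>

lemma abs_diff_diff_perturb:
  fixes e :: real
  assumes "e < \<bar>c - a - b\<bar> / 6" "\<bar>a' - a\<bar> < e / 2" "\<bar>b' - b\<bar> < e / 2" "\<bar>c' - c\<bar> < e / 2"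
  shows "3 * e < \<bar>c' - a' - b'\<bar>"
proof -
  have "\<bar>c - a - b\<bar> \<le> \<bar>c' - a' - b'\<bar> + \<bar>c' - c\<bar> + \<bar>a' - a\<bar> + \<bar>b' - b\<bar>" by simp
  with assms show ?thesis by argo
qed

text \<open>If \<open>x\<close> and \<open>x + t u\<close> both lie in a set where \<open>h\<close> has the approximate slopes \<open>a\<close>, \<open>b\<close>, \<open>c\<close> along
  \<open>u\<close>, \<open>v\<close>, \<open>u + v\<close>, then \<open>c\<close> is close to \<open>a + b\<close>. Otherwise the points of that set on lines parallel to
  \<open>u\<close> are separated, so the set is null.\<close>

lemma AE_dir_deriv_add:
  fixes h :: "'a::euclidean_space \<Rightarrow> real"
  assumes cont: "continuous_on UNIV h"
  shows "AE x in lborel. \<forall>a b c. dir_deriv h x u a \<longrightarrow> dir_deriv h x v b \<longrightarrow> dir_deriv h x (u + v) c \<longrightarrow> c = a + b"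
proof -
  let ?e = "\<lambda>n. inverse (real (Suc n))"
  define A where "A z q n k = {x. \<forall>t. \<bar>t\<bar> < ?e k \<longrightarrow> \<bar>h (x + t *\<^sub>R z) - h x - real_of_rat q * t\<bar> \<le> ?e n * \<bar>t\<bar>}" for z q n k
  have A: "A z q n k \<in> sets borel" for z q n k
    unfolding A_def by (intro borel_closed closed_approx_derivative[OF cont])
  define E where "E a b c n k = A u a n k \<inter> A v b n k \<inter> A (u + v) c n k" for a b c n k
  have "AE x in lborel. x \<notin> E a b c n k" if abc: "3 * ?e n < \<bar>real_of_rat c - of_rat a - of_rat b\<bar>" for a b c n k
  proof (rule AE_not_in_if_slices_null[where v = u])
    show "E a b c n k \<in> sets borel" unfolding E_def using A by blast
    fix x
    have "countable {t. x + t *\<^sub>R u \<in> E a b c n k}"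
    proof (rule countable_if_separated[of "?e k"])
      fix s t assume st: "s \<in> {t. x + t *\<^sub>R u \<in> E a b c n k}" "t \<in> {t. x + t *\<^sub>R u \<in> E a b c n k}" "s \<noteq> t"
      define y where "y = x + s *\<^sub>R u"
      define r where "r = t - s"
      have y: "y \<in> E a b c n k" and yr: "y + r *\<^sub>R u \<in> E a b c n k" and "r \<noteq> 0"
        using st by (auto simp: y_def r_def algebra_simps)
      show "?e k \<le> \<bar>s - t\<bar>"
      proof (rule ccontr)
        assume "\<not> ?e k \<le> \<bar>s - t\<bar>"
        then have r: "\<bar>r\<bar> < ?e k" by (simp add: r_def)
        \<comment> \<open>The point \<open>y + r (u + v)\<close> is reached from \<open>y\<close>
          directly or via \<open>y + r u\<close>. The second leg uses the slope along
          \<open>v\<close> at \<open>y + r u\<close>, which is why both points must lie in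
          \<open>E\<close>.\<close>
        have "\<bar>h (y + r *\<^sub>R u) - h y - of_rat a * r\<bar> \<le> ?e n * \<bar>r\<bar>"
          using y r unfolding E_def A_def by blast
        moreover have "\<bar>h (y + r *\<^sub>R (u + v)) - h y - of_rat c * r\<bar> \<le> ?e n * \<bar>r\<bar>"
          using y r unfolding E_def A_def by blast
        moreover have "\<bar>h (y + r *\<^sub>R u + r *\<^sub>R v) - h (y + r *\<^sub>R u) - of_rat b * r\<bar> \<le> ?e n * \<bar>r\<bar>"
          using yr r unfolding E_def A_def by blast
        ultimately have "\<bar>of_rat c * r - of_rat a * r - of_rat b * r\<bar> \<le> 3 * (?e n * \<bar>r\<bar>)"
          by (simp add: scaleR_add_right add.assoc)
        then have "\<bar>of_rat c - of_rat a - of_rat b\<bar> * \<bar>r\<bar> \<le> (3 * ?e n) * \<bar>r\<bar>"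
          by (simp only: left_diff_distrib[symmetric] abs_mult mult.assoc)
        then show False using abc \<open>r \<noteq> 0\<close> by simp
      qed
    qed simp
    then have "AE t in lborel. t \<notin> {t. x + t *\<^sub>R u \<in> E a b c n k}"
      by (intro AE_not_in countable_imp_null_set_lborel)
    then show "AE t in lborel. x + t *\<^sub>R u \<notin> E a b c n k" by simp
  qed
  then have "AE x in lborel. \<forall>a b c n k. 3 * ?e n < \<bar>real_of_rat c - of_rat a - of_rat b\<bar> \<longrightarrow> x \<notin> E a b c n k"
    unfolding AE_all_countable by (intro allI) (auto intro!: AE_impI)
  then show ?thesis
  proof eventually_elim
    case (elim x)
    show ?case
    proof (intro allI impI, rule ccontr)
      fix a b c assume D: "dir_deriv h x u a" "dir_deriv h x v b" "dir_deriv h x (u + v) c" and "c \<noteq> a + b"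
      then obtain n where n: "?e n < \<bar>c - a - b\<bar> / 6"
        using reals_Archimedean[of "\<bar>c - a - b\<bar> / 6"] by auto
      have *: "\<exists>d q. 0 < d \<and> \<bar>real_of_rat q - w\<bar> < ?e n / 2 \<and>
          (\<forall>t. \<bar>t\<bar> < d \<longrightarrow> \<bar>h (x + t *\<^sub>R z) - h x - of_rat q * t\<bar> \<le> ?e n * \<bar>t\<bar>)"
        if D: "dir_deriv h x z w" for z w
      proof -
        obtain q where q: "w < of_rat q" "of_rat q < w + ?e n / 2"
          using of_rat_dense[of w "w + ?e n / 2"] by auto
        obtain d where d: "0 < d" "\<And>t. \<bar>t\<bar> < d \<Longrightarrow> \<bar>h (x + t *\<^sub>R z) - h x - w * t\<bar> \<le> ?e n / 2 * \<bar>t\<bar>"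
          using dir_derivD[OF D, of "?e n / 2"] by auto
        have "\<bar>h (x + t *\<^sub>R z) - h x - of_rat q * t\<bar> \<le> ?e n * \<bar>t\<bar>" if "\<bar>t\<bar> < d" for t
        proof -
          have "\<bar>(of_rat q - w) * t\<bar> \<le> ?e n / 2 * \<bar>t\<bar>"
            unfolding abs_mult using q by (intro mult_right_mono) auto
          then show ?thesis using d(2)[OF that] unfolding left_diff_distrib by linarith
        qed
        then show ?thesis using d(1) q by (intro exI[of _ d] exI[of _ q]) auto
      qed
      obtain d1 a' where 1: "0 < d1" "\<bar>real_of_rat a' - a\<bar> < ?e n / 2"
        "\<And>t. \<bar>t\<bar> < d1 \<Longrightarrow> \<bar>h (x + t *\<^sub>R u) - h x - of_rat a' * t\<bar> \<le> ?e n * \<bar>t\<bar>" using *[OF D(1)] by blast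
      obtain d2 b' where 2: "0 < d2" "\<bar>real_of_rat b' - b\<bar> < ?e n / 2"
        "\<And>t. \<bar>t\<bar> < d2 \<Longrightarrow> \<bar>h (x + t *\<^sub>R v) - h x - of_rat b' * t\<bar> \<le> ?e n * \<bar>t\<bar>" using *[OF D(2)] by blast
      obtain d3 c' where 3: "0 < d3" "\<bar>real_of_rat c' - c\<bar> < ?e n / 2"
        "\<And>t. \<bar>t\<bar> < d3 \<Longrightarrow> \<bar>h (x + t *\<^sub>R (u + v)) - h x - of_rat c' * t\<bar> \<le> ?e n * \<bar>t\<bar>" using *[OF D(3)] by blast
      obtain k where k: "?e k < min d1 (min d2 d3)"
        using reals_Archimedean[of "min d1 (min d2 d3)"] 1(1) 2(1) 3(1) by auto
      have "x \<in> E a' b' c' n k"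
        unfolding E_def A_def using 1(3) 2(3) 3(3) k by auto
      moreover have "3 * ?e n < \<bar>real_of_rat c' - of_rat a' - of_rat b'\<bar>"
        by (rule abs_diff_diff_perturb[OF n 1(2) 2(2) 3(2)])
      ultimately show False using elim by blast
    qed
  qed
qed

text \<open>Induction over the basis: each step adds one direction by scaling and additivity.
  Quantifying over \<open>D\<close> inside keeps the null set independent of the values of the
  partial derivatives.\<close>

lemma AE_dir_deriv_linear:
  fixes h :: "'a::euclidean_space \<Rightarrow> real"
  assumes h: "\<And>x y. \<bar>h x - h y\<bar> \<le> L * norm (x - y)"
  shows "AE x in lborel. \<forall>D. (\<forall>i\<in>Basis. dir_deriv h x i (D i)) \<longrightarrow> dir_deriv h x v (\<Sum>i\<in>Basis. (v \<bullet> i) * D i)"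
proof -
  have "AE x in lborel. \<forall>D. (\<forall>i\<in>Basis. dir_deriv h x i (D i)) \<longrightarrow>
      dir_deriv h x (\<Sum>i\<in>S. (v \<bullet> i) *\<^sub>R i) (\<Sum>i\<in>S. (v \<bullet> i) * D i)" if "finite S" "S \<subseteq> Basis" for S
    using that
  proof (induction S rule: finite_induct)
    case empty
    show ?case by (auto simp: dir_deriv_def intro!: exI[of _ 1])
  next
    case (insert b S)
    let ?u = "\<Sum>i\<in>S. (v \<bullet> i) *\<^sub>R i" and ?w = "(v \<bullet> b) *\<^sub>R b"
    \<comment> \<open>Additivity presupposes a derivative along the sum, whose existence is a
      separate almost-everywhere statement.\<close>
    have "AE x in lborel. \<exists>c. dir_deriv h x (?w + ?u) c"
      using AE_directional[of "\<lambda>_. h" L "?w + ?u", OF h] by auto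
    moreover note AE_dir_deriv_add[OF continuous_on_if_Lipschitz[OF h], of ?w ?u]
    moreover have "AE x in lborel. \<forall>D. (\<forall>i\<in>Basis. dir_deriv h x i (D i)) \<longrightarrow> dir_deriv h x ?u (\<Sum>i\<in>S. (v \<bullet> i) * D i)"
      using insert by simp
    ultimately show ?case
    proof eventually_elim
      case (elim x)
      show ?case
      proof (intro allI impI)
        fix D assume D: "\<forall>i\<in>Basis. dir_deriv h x i (D i)"
        then have "dir_deriv h x ?w ((v \<bullet> b) * D b)" using insert.prems by (intro dir_deriv_scaleR) auto
        moreover have "dir_deriv h x ?u (\<Sum>i\<in>S. (v \<bullet> i) * D i)" using elim(3) D by blast
        moreover obtain c where c: "dir_deriv h x (?w + ?u) c" using elim(1) by blast
        ultimately have "c = (v \<bullet> b) * D b + (\<Sum>i\<in>S. (v \<bullet> i) * D i)" using elim(2) by blast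
        with c show "dir_deriv h x (\<Sum>i\<in>insert b S. (v \<bullet> i) *\<^sub>R i) (\<Sum>i\<in>insert b S. (v \<bullet> i) * D i)"
          using insert.hyps by simp
      qed
    qed
  qed
  from this[of Basis] show ?thesis by (simp add: euclidean_representation)
qed

section \<open>A simultaneous Rademacher theorem\<close>

text \<open>Finitely many balls of radius \<open>\<eta>\<close> about directions in \<open>V\<close>
  cover the unit sphere. Along these directions \<open>F\<close> is small near 0, and by the
  Lipschitz bound moving from \<open>sgn u\<close> to the nearest of them adds at most
  \<open>e / 2 * norm u\<close>.\<close>

lemma small_o_if_directional:
  fixes F :: "'a::euclidean_space \<Rightarrow> real"
  assumes lip: "\<And>u v. \<bar>F u - F v\<bar> \<le> C * norm (u - v)"
    and dense: "\<And>X. open X \<Longrightarrow> X \<noteq> {} \<Longrightarrow> \<exists>v\<in>V. v \<in> X"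
    and dir: "\<And>v e. v \<in> V \<Longrightarrow> 0 < e \<Longrightarrow> \<exists>d>0. \<forall>t. \<bar>t\<bar> < d \<longrightarrow> \<bar>F (t *\<^sub>R v)\<bar> \<le> e * \<bar>t\<bar>"
    and "0 < e"
  shows "\<exists>d>0. \<forall>u. norm u < d \<longrightarrow> \<bar>F u\<bar> \<le> e * norm u"
proof -
  define c where "c = \<bar>C\<bar> + 1"
  have c: "0 < c" "\<bar>C\<bar> \<le> c" by (auto simp: c_def)
  define \<eta> where "\<eta> = e / (2 * c)"
  have "0 < \<eta>" using \<open>0 < e\<close> c by (simp add: \<eta>_def)
  \<comment> \<open>The directional bound at \<open>t = 0\<close> already forces this.\<close>
  have F0: "F 0 = 0"
  proof -
    obtain v where "v \<in> V" using dense[of UNIV] by auto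
    have "\<bar>F 0\<bar> \<le> 0 + r" if r: "0 < r" for r
      using dir[OF \<open>v \<in> V\<close> zero_less_one] that by (force dest: spec[of _ 0])
    then have "\<bar>F 0\<bar> \<le> 0" by (rule field_le_epsilon)
    then show ?thesis by simp
  qed
  have "sphere 0 1 \<subseteq> (\<Union>v\<in>V. ball v \<eta>)"
  proof
    fix s :: 'a
    obtain v where "v \<in> V" "v \<in> ball s \<eta>" using dense[of "ball s \<eta>"] \<open>0 < \<eta>\<close> by auto
    then show "s \<in> (\<Union>v\<in>V. ball v \<eta>)" by (auto simp: dist_commute)
  qed
  then obtain W where W: "W \<subseteq> V" "finite W" "sphere 0 1 \<subseteq> (\<Union>v\<in>W. ball v \<eta>)"
    by (rule compactE_image[OF compact_sphere open_ball])
  have "\<forall>v\<in>W. \<exists>d>0. \<forall>t. \<bar>t\<bar> < d \<longrightarrow> \<bar>F (t *\<^sub>R v)\<bar> \<le> e / 2 * \<bar>t\<bar>"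
    using dir \<open>0 < e\<close> W(1) by (meson half_gt_zero subset_iff)
  then obtain \<delta> where \<delta>: "\<And>v. v \<in> W \<Longrightarrow> 0 < \<delta> v"
      "\<And>v t. v \<in> W \<Longrightarrow> \<bar>t\<bar> < \<delta> v \<Longrightarrow> \<bar>F (t *\<^sub>R v)\<bar> \<le> e / 2 * \<bar>t\<bar>" by metis
  define d where "d = Min (insert 1 (\<delta> ` W))"
  have "0 < d" unfolding d_def using W(2) \<delta>(1) by (subst Min_gr_iff) auto
  moreover have "\<bar>F u\<bar> \<le> e * norm u" if u: "norm u < d" for u
  proof (cases "u = 0")
    case False
    then have "sgn u \<in> sphere 0 1" by (simp add: norm_sgn)
    then obtain v where v: "v \<in> W" "dist v (sgn u) < \<eta>" using W(3) by auto
    have "norm u < \<delta> v" using u v(1) W(2) by (simp add: d_def)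
    then have "\<bar>F (norm u *\<^sub>R v)\<bar> \<le> e / 2 * norm u" using \<delta>(2)[OF v(1), of "norm u"] by simp
    moreover have "\<bar>F u - F (norm u *\<^sub>R v)\<bar> \<le> e / 2 * norm u"
    proof -
      have "u - norm u *\<^sub>R v = norm u *\<^sub>R (sgn u - v)" by (simp add: sgn_div_norm scaleR_diff_right False)
      then have n: "norm (u - norm u *\<^sub>R v) = norm u * dist v (sgn u)"
        by (simp add: dist_norm norm_minus_commute)
      have "\<bar>F u - F (norm u *\<^sub>R v)\<bar> \<le> C * (norm u * dist v (sgn u))" using lip[of u "norm u *\<^sub>R v"] n by simp
      also have "\<dots> \<le> \<bar>C\<bar> * (norm u * dist v (sgn u))" by (intro mult_right_mono) auto
      also have "\<dots> \<le> \<bar>C\<bar> * (norm u * \<eta>)" using v by (intro mult_left_mono) auto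
      also have "\<dots> \<le> c * (norm u * \<eta>)" using c \<open>0 < \<eta>\<close> by (intro mult_right_mono) auto
      also have "\<dots> = e / 2 * norm u" using c by (simp add: \<eta>_def)
      finally show ?thesis .
    qed
    ultimately show ?thesis by linarith
  qed (simp add: F0)
  ultimately show ?thesis by blast
qed

text \<open>The bound depends on \<open>h\<close> only through \<open>L\<close>, which keeps the
  supremum of the derivatives of a whole sequence finite.\<close>

lemma has_derivative_Lipschitz_bound:
  fixes h :: "'a::real_normed_vector \<Rightarrow> real"
  assumes D: "(h has_derivative l) (at x)" and lip: "\<And>y. \<bar>h y - h x\<bar> \<le> L * norm (y - x)"
  shows "\<bar>l u\<bar> \<le> L * norm u"
proof (cases "u = 0")
  case True
  then show ?thesis using has_derivative_bounded_linear[OF D] by (simp add: bounded_linear.linear linear_0)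
next
  case False
  show ?thesis
  proof (rule field_le_epsilon)
    fix e :: real assume "0 < e"
    then obtain d where d: "0 < d" "\<And>y. norm (y - x) < d \<Longrightarrow> \<bar>h y - h x - l (y - x)\<bar> \<le> e / norm u * norm (y - x)"
      using D False unfolding has_derivative_at_alt by (fastforce dest: spec[of _ "e / norm u"])
    define t where "t = d / (2 * norm u)"
    have t: "0 < t" "t * norm u < d" using False d(1) by (auto simp: t_def)
    have "l (t *\<^sub>R u) = t * l u" using has_derivative_bounded_linear[OF D] by (simp add: bounded_linear.linear linear_scale)
    then have "\<bar>h (x + t *\<^sub>R u) - h x - t * l u\<bar> \<le> e * t"
      using d(2)[of "x + t *\<^sub>R u"] t False by simp
    moreover have "\<bar>h (x + t *\<^sub>R u) - h x\<bar> \<le> t * (L * norm u)"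
      using lip[of "x + t *\<^sub>R u"] t by (simp add: mult_ac)
    ultimately have "\<bar>t * l u\<bar> \<le> t * (L * norm u + e)" unfolding distrib_left by argo
    then have "t * \<bar>l u\<bar> \<le> t * (L * norm u + e)" using t by (simp add: abs_mult)
    then show "\<bar>l u\<bar> \<le> L * norm u + e" using t by simp
  qed
qed

text \<open>This passes a Lipschitz bound common to all members of a sequence on to their pointwise
  supremum.\<close>

lemma abs_cSUP_diff_le:
  fixes f g :: "nat \<Rightarrow> real"
  assumes f: "bdd_above (range f)" and g: "bdd_above (range g)" and B: "\<And>j. \<bar>f j - g j\<bar> \<le> B"
  shows "\<bar>(SUP j. f j) - (SUP j. g j)\<bar> \<le> B"
proof -
  have "(SUP j. f j) \<le> (SUP j. g j) + B"
  proof (rule cSUP_least)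
    fix j show "f j \<le> (SUP j. g j) + B" using B[of j] cSUP_upper[OF UNIV_I g, of j] by linarith
  qed simp
  moreover have "(SUP j. g j) \<le> (SUP j. f j) + B"
  proof (rule cSUP_least)
    fix j show "g j \<le> (SUP j. f j) + B" using B[of j] cSUP_upper[OF UNIV_I f, of j] by linarith
  qed simp
  ultimately show ?thesis by linarith
qed

text \<open>Countably many dense directions together with the basis produce one null set. Outside it
  the remainder of each \<open>h j\<close>, and likewise the difference of the two suprema, is
  Lipschitz in the increment and small along each dense direction, so
  \<open>small_o_if_directional\<close> applies to both.\<close>

theorem Lipschitz_sequence_AE_differentiable:
  fixes h :: "nat \<Rightarrow> 'a::euclidean_space \<Rightarrow> real"
  assumes h: "\<And>j x y. \<bar>h j x - h j y\<bar> \<le> L * norm (x - y)"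
  shows "AE x in lborel. \<exists>l. (\<forall>j. (h j has_derivative l j) (at x)) \<and>
    (\<forall>e>0. \<exists>d>0. \<forall>u. norm u < d \<longrightarrow>
       \<bar>(SUP j. \<bar>h j (x + u) - h j x\<bar>) - (SUP j. \<bar>l j u\<bar>)\<bar> \<le> e * norm u)"
proof -
  obtain V :: "'a set" where V: "countable V" "\<And>X. open X \<Longrightarrow> X \<noteq> {} \<Longrightarrow> \<exists>v\<in>V. v \<in> X"
    by (rule countable_dense_setE) blast
  let ?P = "\<lambda>x v. (\<forall>j. \<exists>c. dir_deriv (h j) x v c) \<and>
     (\<forall>e>0. \<exists>d>0. \<exists>i. \<forall>t. \<bar>t\<bar> < d \<longrightarrow>
        (\<forall>j. \<bar>h j (x + t *\<^sub>R v) - h j x\<bar> \<le> \<bar>h i (x + t *\<^sub>R v) - h i x\<bar> + e * \<bar>t\<bar>))"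
  let ?Q = "\<lambda>x v j. \<forall>D. (\<forall>i\<in>Basis. dir_deriv (h j) x i (D i)) \<longrightarrow> dir_deriv (h j) x v (\<Sum>i\<in>Basis. (v \<bullet> i) * D i)"
  have "countable (V \<union> Basis)" using V(1) by (simp add: countable_finite)
  then have "AE x in lborel. \<forall>v\<in>V \<union> Basis. ?P x v"
    by (subst AE_ball_countable) (use AE_directional[OF h] in auto)
  moreover have "AE x in lborel. \<forall>v\<in>V. \<forall>j. ?Q x v j"
    using V(1) by (simp only: AE_ball_countable AE_all_countable) (intro ballI allI AE_dir_deriv_linear[OF h])
  ultimately show ?thesis
  proof eventually_elim
    case (elim x)
    from elim(1) have "\<forall>j. \<forall>i\<in>Basis. \<exists>c. dir_deriv (h j) x i c" by blast
    then obtain D where D: "\<And>j i. i \<in> Basis \<Longrightarrow> dir_deriv (h j) x i (D j i)" by metis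
    define l where "l j u = (\<Sum>i\<in>Basis. (u \<bullet> i) * D j i)" for j u
    have lV: "dir_deriv (h j) x v (l j v)" if "v \<in> V" for j v
      using elim(2) that D unfolding l_def by blast
    have bl: "bounded_linear (l j)" for j
      unfolding l_def by (intro bounded_linear_sum bounded_linear_mult_const bounded_linear_inner_left)
    have der: "(h j has_derivative l j) (at x)" for j
    proof -
      obtain K where K: "\<And>u. norm (l j u) \<le> norm u * K" using bl[of j] bounded_linear.bounded by blast
      have "\<exists>d>0. \<forall>u. norm u < d \<longrightarrow> \<bar>h j (x + u) - h j x - l j u\<bar> \<le> e * norm u" if "0 < e" for e
      proof (rule small_o_if_directional[OF _ V(2) _ that])
        fix u v
        have "l j u - l j v = l j (u - v)" using bl[of j] by (simp add: bounded_linear.linear linear_diff)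
        then show "\<bar>(h j (x + u) - h j x - l j u) - (h j (x + v) - h j x - l j v)\<bar> \<le> (L + K) * norm (u - v)"
          using h[of j "x + u" "x + v"] K[of "u - v"] by (simp add: algebra_simps)
      next
        fix v and e :: real assume "v \<in> V" "0 < e"
        have "l j (t *\<^sub>R v) = l j v * t" for t using bl[of j] by (simp add: bounded_linear.linear linear_scale)
        then show "\<exists>d>0. \<forall>t. \<bar>t\<bar> < d \<longrightarrow> \<bar>h j (x + t *\<^sub>R v) - h j x - l j (t *\<^sub>R v)\<bar> \<le> e * \<bar>t\<bar>"
          using lV[OF \<open>v \<in> V\<close>, of j] \<open>0 < e\<close> unfolding dir_deriv_def by simp
      qed
      then show ?thesis
        unfolding has_derivative_at_alt using bl[of j] by (metis add_diff_cancel_left' diff_add_cancel add.commute real_norm_def)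
    qed
    have lL: "\<bar>l j u\<bar> \<le> L * norm u" for j u
      by (rule has_derivative_Lipschitz_bound[OF der h])
    define S where "S u = (SUP j. \<bar>h j (x + u) - h j x\<bar>)" for u
    define \<sigma> where "\<sigma> u = (SUP j. \<bar>l j u\<bar>)" for u
    have bS: "bdd_above (range (\<lambda>j. \<bar>h j (x + u) - h j x\<bar>))" for u
      using h[of _ "x + u" x] by (intro bdd_aboveI[of _ "L * norm u"]) auto
    have b\<sigma>: "bdd_above (range (\<lambda>j. \<bar>l j u\<bar>))" for u
      using lL by (intro bdd_aboveI[of _ "L * norm u"]) auto
    have S_lip: "\<bar>S u - S v\<bar> \<le> L * norm (u - v)" for u v
      unfolding S_def
    proof (rule abs_cSUP_diff_le[OF bS bS])
      fix j show "\<bar>\<bar>h j (x + u) - h j x\<bar> - \<bar>h j (x + v) - h j x\<bar>\<bar> \<le> L * norm (u - v)"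
        using h[of j "x + u" "x + v"] by simp
    qed
    have \<sigma>_lip: "\<bar>\<sigma> u - \<sigma> v\<bar> \<le> L * norm (u - v)" for u v
      unfolding \<sigma>_def
    proof (rule abs_cSUP_diff_le[OF b\<sigma> b\<sigma>])
      fix j
      have "l j u - l j v = l j (u - v)" using bl[of j] by (simp add: bounded_linear.linear linear_diff)
      then show "\<bar>\<bar>l j u\<bar> - \<bar>l j v\<bar>\<bar> \<le> L * norm (u - v)"
        using lL[of j "u - v"] abs_triangle_ineq3[of "l j u" "l j v"] by simp
    qed
    have "\<exists>d>0. \<forall>u. norm u < d \<longrightarrow> \<bar>S u - \<sigma> u\<bar> \<le> e * norm u" if "0 < e" for e
    proof (rule small_o_if_directional[OF _ V(2) _ that])
      fix u v show "\<bar>(S u - \<sigma> u) - (S v - \<sigma> v)\<bar> \<le> (L + L) * norm (u - v)"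
        using S_lip[of u v] \<sigma>_lip[of u v] unfolding distrib_right by linarith
    next
      fix v and e :: real assume v: "v \<in> V" and "0 < e"
      then have e3: "0 < e / 3" by simp
      \<comment> \<open>A single index \<open>i\<close> nearly dominates all increments along
        \<open>v\<close>; comparing it with its own derivative bounds \<open>S\<close> from
        above.\<close>
      have "\<exists>d>0. \<exists>i. \<forall>t. \<bar>t\<bar> < d \<longrightarrow>
        (\<forall>j. \<bar>h j (x + t *\<^sub>R v) - h j x\<bar> \<le> \<bar>h i (x + t *\<^sub>R v) - h i x\<bar> + e / 3 * \<bar>t\<bar>)"
        using elim(1)[THEN bspec, OF UnI1[OF v], THEN conjunct2, THEN spec, THEN mp, OF e3] .
      then obtain d1 i where d1: "0 < d1" "\<And>t j. \<bar>t\<bar> < d1 \<Longrightarrow>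
          \<bar>h j (x + t *\<^sub>R v) - h j x\<bar> \<le> \<bar>h i (x + t *\<^sub>R v) - h i x\<bar> + e / 3 * \<bar>t\<bar>" by blast
      obtain d2 where d2: "0 < d2" "\<And>t. \<bar>t\<bar> < d2 \<Longrightarrow> \<bar>h i (x + t *\<^sub>R v) - h i x - l i v * t\<bar> \<le> e / 3 * \<bar>t\<bar>"
        using dir_derivD[OF lV[OF v] e3] by blast
      \<comment> \<open>The index \<open>k\<close> nearly attains \<open>\<sigma> v\<close>; by
        homogeneity it serves all multiples of \<open>v\<close> and bounds \<open>S\<close> from
        below.\<close>
      obtain k where k: "\<sigma> v - e / 3 < \<bar>l k v\<bar>"
        using less_cSUP_iff[OF _ b\<sigma>[of v], of "\<sigma> v - e / 3"] e3 unfolding \<sigma>_def by auto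
      obtain d3 where d3: "0 < d3" "\<And>t. \<bar>t\<bar> < d3 \<Longrightarrow> \<bar>h k (x + t *\<^sub>R v) - h k x - l k v * t\<bar> \<le> e / 3 * \<bar>t\<bar>"
        using dir_derivD[OF lV[OF v] e3] by blast
      have lt: "\<bar>l j (t *\<^sub>R v)\<bar> = \<bar>l j v * t\<bar>" for j t using bl[of j] by (simp add: bounded_linear.linear linear_scale abs_mult)
      have "\<bar>S (t *\<^sub>R v) - \<sigma> (t *\<^sub>R v)\<bar> \<le> e * \<bar>t\<bar>" if t: "\<bar>t\<bar> < min d1 (min d2 d3)" for t
      proof -
        have "S (t *\<^sub>R v) \<le> \<sigma> (t *\<^sub>R v) + 2 * (e / 3 * \<bar>t\<bar>)"
          unfolding S_def
        proof (rule cSUP_least)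
          fix j
          have "\<bar>l i v * t\<bar> \<le> \<sigma> (t *\<^sub>R v)"
            unfolding \<sigma>_def lt[symmetric] by (rule cSUP_upper[OF UNIV_I b\<sigma>])
          then show "\<bar>h j (x + t *\<^sub>R v) - h j x\<bar> \<le> \<sigma> (t *\<^sub>R v) + 2 * (e / 3 * \<bar>t\<bar>)"
            using d1(2)[of t j] d2(2)[of t] t by linarith
        qed simp
        moreover have "\<sigma> (t *\<^sub>R v) \<le> S (t *\<^sub>R v) + 2 * (e / 3 * \<bar>t\<bar>)"
          unfolding \<sigma>_def
        proof (rule cSUP_least)
          fix j
          have "\<bar>l j v\<bar> \<le> \<bar>l k v\<bar> + e / 3"
            using cSUP_upper[OF UNIV_I b\<sigma>[of v], of j] k unfolding \<sigma>_def by linarith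
          then have "\<bar>l j v\<bar> * \<bar>t\<bar> \<le> (\<bar>l k v\<bar> + e / 3) * \<bar>t\<bar>" by (intro mult_right_mono) auto
          then have "\<bar>l j (t *\<^sub>R v)\<bar> \<le> \<bar>l k v * t\<bar> + e / 3 * \<bar>t\<bar>" by (simp only: lt abs_mult distrib_right)
          moreover have "\<bar>h k (x + t *\<^sub>R v) - h k x\<bar> \<le> S (t *\<^sub>R v)"
            unfolding S_def by (rule cSUP_upper[OF UNIV_I bS])
          ultimately show "\<bar>l j (t *\<^sub>R v)\<bar> \<le> S (t *\<^sub>R v) + 2 * (e / 3 * \<bar>t\<bar>)"
            using d3(2)[of t] t by linarith
        qed simp
        moreover have "2 * (e / 3 * \<bar>t\<bar>) \<le> e * \<bar>t\<bar>" using \<open>0 < e\<close> by simp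
        ultimately show ?thesis by linarith
      qed
      then show "\<exists>d>0. \<forall>t. \<bar>t\<bar> < d \<longrightarrow> \<bar>S (t *\<^sub>R v) - \<sigma> (t *\<^sub>R v)\<bar> \<le> e * \<bar>t\<bar>"
        using d1(1) d2(1) d3(1) by (intro exI[of _ "min d1 (min d2 d3)"]) auto
    qed
    with der show ?case unfolding S_def \<sigma>_def by blast
  qed
qed

section \<open>The dual gradient\<close>

text \<open>McShane's formula. It lets functions that are Lipschitz only on \<open>\<Omega>\<close>
  enter the theorem about the whole space.\<close>

lemma Lipschitz_extension_real:
  fixes f :: "'a::metric_space \<Rightarrow> real"
  assumes "S \<noteq> {}" and "0 \<le> L" and f: "\<And>x y. x \<in> S \<Longrightarrow> y \<in> S \<Longrightarrow> \<bar>f x - f y\<bar> \<le> L * dist x y"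
  shows "\<exists>g. (\<forall>x\<in>S. g x = f x) \<and> (\<forall>x y. \<bar>g x - g y\<bar> \<le> L * dist x y)"
proof -
  define g where "g x = (INF y\<in>S. f y + L * dist x y)" for x
  obtain y0 where y0: "y0 \<in> S" using assms(1) by blast
  have tri: "L * dist x z \<le> L * dist x y + L * dist y z" for x y z :: 'a
    using mult_left_mono[OF dist_triangle \<open>0 \<le> L\<close>] by (simp add: distrib_left)
  have bdd: "bdd_below ((\<lambda>y. f y + L * dist x y) ` S)" for x
  proof (rule bdd_belowI2)
    fix y assume "y \<in> S"
    then show "f y0 - L * dist x y0 \<le> f y + L * dist x y"
      using f[OF y0, of y] tri[of y0 y x] by (simp add: dist_commute abs_le_iff)
  qed
  have low: "g x \<le> f y + L * dist x y" if "y \<in> S" for x y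
    unfolding g_def using bdd that by (rule cINF_lower)
  have half: "g x \<le> g z + L * dist x z" for x z
  proof -
    have "g x - L * dist x z \<le> g z"
      unfolding g_def[of z]
    proof (rule cINF_greatest[OF assms(1)])
      fix y assume "y \<in> S"
      then show "g x - L * dist x z \<le> f y + L * dist z y" using low[of y x] tri[of x y z] by simp
    qed
    then show ?thesis by simp
  qed
  have "g x = f x" if "x \<in> S" for x
  proof (rule antisym)
    show "g x \<le> f x" using low[OF that, of x] by simp
    show "f x \<le> g x" unfolding g_def
    proof (rule cINF_greatest[OF assms(1)])
      fix y assume "y \<in> S"
      then show "f x \<le> f y + L * dist x y" using f[OF that, of y] by simp
    qed
  qed
  moreover have "\<bar>g x - g y\<bar> \<le> L * dist x y" for x y
    using half[of x y] half[of y x] by (simp add: dist_commute abs_le_iff)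
  ultimately show ?thesis by blast
qed

section \<open>Weak-star cluster points and difference quotients in the dual\<close>

text \<open>The functional is a cluster point of the sequence in the compact product of the intervals
  \<open>[-C \<parallel>\<phi>\<parallel>, C \<parallel>\<phi>\<parallel>]\<close>.\<close>

lemma blinfun_weak_star_cluster_point:
  fixes \<Lambda> :: "nat \<Rightarrow> 'a::real_normed_vector \<Rightarrow>\<^sub>L real"
  assumes bound: "\<And>k. norm (\<Lambda> k) \<le> C"
  shows "\<exists>l :: 'a \<Rightarrow>\<^sub>L real. \<forall>\<phi> c. (\<lambda>k. \<Lambda> k \<phi>) \<longlonglongrightarrow> c \<longrightarrow> l \<phi> = c"
proof -
  define K where "K = PiE UNIV (\<lambda>\<phi>::'a. cball (0::real) (C * norm \<phi>))"
  \<comment> \<open>Tychonoff's theorem, for the product topology that the function type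
    carries.\<close>
  have "compact K"
    unfolding K_def compactin_euclidean_iff[symmetric] euclidean_product_topology[symmetric]
    by (simp add: compactin_PiE)
  define F where "F = filtermap (\<lambda>k. blinfun_apply (\<Lambda> k)) sequentially"
  have "F \<noteq> bot" by (simp add: F_def filtermap_bot_iff)
  moreover have "eventually (\<lambda>g. g \<in> K) F"
    unfolding F_def eventually_filtermap
  proof (intro always_eventually allI)
    fix k
    have "\<bar>blinfun_apply (\<Lambda> k) \<phi>\<bar> \<le> C * norm \<phi>" for \<phi>
      using norm_blinfun[of "\<Lambda> k" \<phi>] mult_right_mono[OF bound[of k] norm_ge_zero[of \<phi>]] by simp
    then show "blinfun_apply (\<Lambda> k) \<in> K" by (auto simp: K_def PiE_UNIV_domain)
  qed
  ultimately obtain l where l: "l \<in> K" "inf (nhds l) F \<noteq> bot"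
    using \<open>compact K\<close> unfolding compact_filter by blast
  \<comment> \<open>\<open>H\<close> refines the sequence and converges pointwise to
    \<open>l\<close>; it plays the role of a convergent subnet.\<close>
  define H where "H = inf (nhds l) F"
  have lim: "((\<lambda>g. g \<phi>) \<longlongrightarrow> l \<phi>) H" for \<phi>
  proof (rule tendsto_mono)
    show "H \<le> nhds l" by (simp add: H_def)
    show "((\<lambda>g. g \<phi>) \<longlongrightarrow> l \<phi>) (nhds l)"
      by (rule continuous_on_tendsto_compose[OF continuous_on_product_coordinates filterlim_ident]) auto
  qed
  \<comment> \<open>What holds for every \<open>\<Lambda> k\<close> holds along \<open>H\<close>;
    this passes linearity on to the limit.\<close>
  have ev: "eventually P H" if "\<And>k. P (blinfun_apply (\<Lambda> k))" for P
    using that unfolding H_def by (intro filter_leD[OF inf_le2]) (simp add: F_def eventually_filtermap)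
  have H: "H \<noteq> bot" using l(2) by (simp add: H_def)
  have "bounded_linear l"
  proof (rule bounded_linear_intro)
    fix \<phi> \<psi> :: 'a and r :: real
    have "((\<lambda>g. g (\<phi> + \<psi>)) \<longlongrightarrow> l \<phi> + l \<psi>) H"
      by (rule Lim_transform_eventually[OF tendsto_add[OF lim lim]]) (rule ev, simp add: blinfun.add_right)
    then show "l (\<phi> + \<psi>) = l \<phi> + l \<psi>" using lim H by (metis tendsto_unique)
    have "((\<lambda>g. g (r *\<^sub>R \<phi>)) \<longlongrightarrow> r *\<^sub>R l \<phi>) H"
      by (rule Lim_transform_eventually[OF tendsto_scaleR[OF tendsto_const lim]]) (rule ev, simp add: blinfun.scaleR_right)
    then show "l (r *\<^sub>R \<phi>) = r *\<^sub>R l \<phi>" using lim H by (metis tendsto_unique)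
    show "norm (l \<phi>) \<le> norm \<phi> * C" using l(1) by (auto simp: K_def PiE_UNIV_domain mult.commute)
  qed
  moreover have "l \<phi> = c" if c: "(\<lambda>k. \<Lambda> k \<phi>) \<longlonglongrightarrow> c" for \<phi> c
  proof -
    have "((\<lambda>g. g \<phi>) \<longlongrightarrow> c) F" using c by (simp add: F_def filterlim_filtermap)
    then have "((\<lambda>g. g \<phi>) \<longlongrightarrow> c) H" by (rule tendsto_mono[rotated]) (simp add: H_def)
    then show ?thesis using lim H by (metis tendsto_unique)
  qed
  ultimately show ?thesis by (intro exI[of _ "Blinfun l"]) (simp add: bounded_linear_Blinfun_apply)
qed

definition lip0_diff :: "'a::pointed_metric_space \<Rightarrow> 'a \<Rightarrow> 'a lip0_dual" where
  "lip0_diff a b = Blinfun (\<lambda>\<phi>. lip0_apply \<phi> a - lip0_apply \<phi> b)"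

lemma lip0_diff_apply: "lip0_diff a b \<phi> = lip0_apply \<phi> a - lip0_apply \<phi> b"
proof -
  have "bounded_linear (\<lambda>\<phi>. lip0_apply \<phi> a - lip0_apply \<phi> b)"
  proof (rule bounded_linear_intro)
    show "norm (lip0_apply \<phi> a - lip0_apply \<phi> b) \<le> norm \<phi> * dist a b" for \<phi>
      using lip0_apply_bound[of \<phi> a b] by simp
  qed (simp_all add: plus_lip0.rep_eq scaleR_lip0.rep_eq algebra_simps)
  then show ?thesis by (simp add: lip0_diff_def bounded_linear_Blinfun_apply)
qed

lemma norm_lip0_diff_le: "norm (lip0_diff a b) \<le> dist a b"
  by (rule norm_blinfun_bound) (use lip0_apply_bound[of _ a b] in \<open>auto simp: lip0_diff_apply mult.commute\<close>)

text \<open>One cluster point serves all \<open>\<phi>\<close> at once: the difference quotients in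
  the dual are bounded by \<open>L * norm v\<close>, and wherever the derivative of the composition
  exists, their values at \<open>\<phi>\<close> converge to it.\<close>

lemma dual_directional_derivative_exists:
  fixes f :: "'b::euclidean_space \<Rightarrow> 'a::pointed_metric_space"
  assumes "open \<Omega>" "x \<in> \<Omega>" and f: "L-lipschitz_on \<Omega> f"
  shows "\<exists>\<Lambda> :: 'a lip0_dual. \<forall>\<phi>. (lip0_apply \<phi> \<circ> f) differentiable (at x) \<longrightarrow>
     \<Lambda> \<phi> = frechet_derivative (lip0_apply \<phi> \<circ> f) (at x) v"
proof -
  obtain r where r: "0 < r" "ball x r \<subseteq> \<Omega>" using assms openE by blast
  \<comment> \<open>These step sizes tend to 0 and keep \<open>x + t k v\<close> in the ball; the
    summand 1 covers \<open>v = 0\<close>.\<close>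
  define t where "t k = r / (norm v + 1) * inverse (real (Suc k))" for k
  have "0 < r / (norm v + 1)" using r by (simp add: add_nonneg_pos)
  then have t0: "0 < t k" for k unfolding t_def by (rule mult_pos_pos) simp
  have tr: "t k * norm v < r" for k
  proof -
    have "t k * norm v \<le> r / (norm v + 1) * 1 * norm v"
      unfolding t_def using r \<open>0 < r / (norm v + 1)\<close> by (intro mult_right_mono mult_left_mono) (auto simp: inverse_le_1_iff)
    also have "\<dots> < r" using r by (simp add: divide_less_eq add_nonneg_pos)
    finally show ?thesis .
  qed
  then have in\<Omega>: "x + t k *\<^sub>R v \<in> \<Omega>" for k
    using r t0[of k] by (intro subsetD[OF r(2)]) (simp add: dist_norm abs_of_pos)
  have "t \<longlonglongrightarrow> r / (norm v + 1) * 0"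
    unfolding t_def by (intro tendsto_intros LIMSEQ_inverse_real_of_nat)
  then have tlim: "filterlim t (at 0) sequentially"
    using t0 by (simp add: filterlim_at less_imp_neq[symmetric])
  define \<Lambda> where "\<Lambda> k = lip0_diff (f (x + t k *\<^sub>R v)) (f x) /\<^sub>R t k" for k
  have "norm (\<Lambda> k) \<le> L * norm v" for k
  proof -
    have "norm (lip0_diff (f (x + t k *\<^sub>R v)) (f x)) \<le> L * dist (x + t k *\<^sub>R v) x"
      using norm_lip0_diff_le lipschitz_onD[OF f in\<Omega>[of k] assms(2)] by (rule order_trans)
    then show ?thesis using t0[of k] by (simp add: \<Lambda>_def dist_norm field_simps)
  qed
  then obtain l :: "'a lip0_dual" where l: "\<And>\<phi> c. (\<lambda>k. \<Lambda> k \<phi>) \<longlonglongrightarrow> c \<Longrightarrow> l \<phi> = c"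
    using blinfun_weak_star_cluster_point[of \<Lambda>] by blast
  have "l \<phi> = frechet_derivative (lip0_apply \<phi> \<circ> f) (at x) v"
    if d: "(lip0_apply \<phi> \<circ> f) differentiable (at x)" for \<phi>
  proof (rule l)
    let ?g = "lip0_apply \<phi> \<circ> f"
    let ?D = "frechet_derivative ?g (at x)"
    have D: "(?g has_derivative ?D) (at x)" using d frechet_derivative_works by blast
    have "((\<lambda>s. ?g (x + s *\<^sub>R v)) has_derivative (\<lambda>s. ?D (s *\<^sub>R v))) (at 0)"
    proof (rule has_derivative_compose[where g = ?g and f = "\<lambda>s. x + s *\<^sub>R v"])
      show "((\<lambda>s. x + s *\<^sub>R v) has_derivative (\<lambda>s. s *\<^sub>R v)) (at 0)" by (auto intro!: derivative_eq_intros)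
      show "(?g has_derivative ?D) (at (x + 0 *\<^sub>R v))" using D by simp
    qed
    moreover have "?D (s *\<^sub>R v) = ?D v * s" for s
      using D by (simp add: has_derivative_linear linear_scale)
    ultimately have "((\<lambda>s. ?g (x + s *\<^sub>R v)) has_real_derivative ?D v) (at 0)"
      by (simp add: has_field_derivative_def)
    then have "(\<lambda>s. (?g (x + s *\<^sub>R v) - ?g x) / s) \<midarrow>0\<rightarrow> ?D v" by (simp add: DERIV_def)
    from filterlim_compose[OF this tlim]
    show "(\<lambda>k. \<Lambda> k \<phi>) \<longlonglongrightarrow> ?D v"
      by (simp add: \<Lambda>_def lip0_diff_apply blinfun.scaleR_left divide_inverse mult.commute)
  qed
  then show ?thesis by blast
qed

text \<open>Cluster points chosen separately for each direction need not depend linearly on it. Only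
  those of the basis directions are kept and extended linearly; linearity of the classical
  derivative then yields every \<open>\<nu>\<close>.\<close>

lemma dual_gradient_exists:
  fixes f :: "'b::euclidean_space \<Rightarrow> 'a::pointed_metric_space"
  assumes "open \<Omega>" "x \<in> \<Omega>" "L-lipschitz_on \<Omega> f"
  shows "\<exists>G :: 'b \<Rightarrow>\<^sub>L 'a lip0_dual. \<forall>\<phi> \<nu>. (lip0_apply \<phi> \<circ> f) differentiable (at x) \<longrightarrow>
     G \<nu> \<phi> = frechet_derivative (lip0_apply \<phi> \<circ> f) (at x) \<nu>"
proof -
  obtain \<Lambda> :: "'b \<Rightarrow> 'a lip0_dual" where \<Lambda>: "\<And>\<phi> i. (lip0_apply \<phi> \<circ> f) differentiable (at x) \<Longrightarrow>
     \<Lambda> i \<phi> = frechet_derivative (lip0_apply \<phi> \<circ> f) (at x) i"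
    using dual_directional_derivative_exists[OF assms] by metis
  define G where "G = Blinfun (\<lambda>\<nu>. \<Sum>i\<in>Basis. (\<nu> \<bullet> i) *\<^sub>R \<Lambda> i)"
  have "bounded_linear (\<lambda>\<nu>. \<Sum>i\<in>Basis. (\<nu> \<bullet> i) *\<^sub>R \<Lambda> i)"
    by (intro bounded_linear_sum bounded_linear_scaleR_const bounded_linear_inner_left)
  then have G: "G \<nu> = (\<Sum>i\<in>Basis. (\<nu> \<bullet> i) *\<^sub>R \<Lambda> i)" for \<nu>
    by (simp add: G_def bounded_linear_Blinfun_apply)
  have "G \<nu> \<phi> = frechet_derivative (lip0_apply \<phi> \<circ> f) (at x) \<nu>"
    if d: "(lip0_apply \<phi> \<circ> f) differentiable (at x)" for \<phi> \<nu>
  proof -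
    let ?D = "frechet_derivative (lip0_apply \<phi> \<circ> f) (at x)"
    have lin: "linear ?D" using d frechet_derivative_works has_derivative_linear by blast
    have "?D \<nu> = ?D (\<Sum>i\<in>Basis. (\<nu> \<bullet> i) *\<^sub>R i)" by (simp add: euclidean_representation)
    also have "\<dots> = (\<Sum>i\<in>Basis. (\<nu> \<bullet> i) * ?D i)" using lin by (simp add: linear_sum linear_scale)
    finally show ?thesis by (simp add: G blinfun.sum_left blinfun.scaleR_left \<Lambda>[OF d])
  qed
  then show ?thesis by blast
qed

section \<open>The metric differential\<close>

lemma abs_dist_diff_le: "\<bar>dist (x::'a::metric_space) p - dist y p\<bar> \<le> dist x y"
  using dist_triangle[of x p y] dist_triangle[of y p x] by (simp add: dist_commute abs_le_iff)

section \<open>Distance functions and the seminorm on the dual\<close>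

text \<open>These are the coordinates of the Kuratowski embedding; the subtracted constant makes
  them vanish at the base point and cancels in all increments.\<close>

definition distance_lip0 :: "'a::pointed_metric_space \<Rightarrow> 'a lip0" where
  "distance_lip0 p = Lip0 (\<lambda>z. dist z p - dist base_point p)"

lemma distance_lip0_apply: "lip0_apply (distance_lip0 p) z = dist z p - dist base_point p"
proof -
  have "\<exists>C. C-lipschitz_on UNIV (\<lambda>z. dist z p - dist base_point p)"
    by (rule lipschitz_realI[of 1]) (use abs_dist_diff_le in auto)
  then show ?thesis by (simp add: distance_lip0_def Lip0_inverse)
qed

lemma norm_distance_lip0_le: "norm (distance_lip0 p) \<le> 1"
  by (rule norm_lip0_le) (use abs_dist_diff_le in \<open>auto simp: distance_lip0_apply\<close>)

text \<open>The distance functions have norm at most 1, so the dual norm is a bound; a real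
  \<open>SUP\<close> is meaningful only with one.\<close>

lemma bdd_above_dual_distance:
  fixes \<Lambda> :: "'a::pointed_metric_space lip0_dual"
  shows "bdd_above (range (\<lambda>j::nat. \<bar>\<Lambda> (distance_lip0 (p j))\<bar>))"
proof (rule bdd_aboveI2)
  fix j
  have "\<bar>\<Lambda> (distance_lip0 (p j))\<bar> \<le> norm \<Lambda> * norm (distance_lip0 (p j))"
    using norm_blinfun[of \<Lambda> "distance_lip0 (p j)"] by simp
  also have "\<dots> \<le> norm \<Lambda> * 1" by (intro mult_left_mono norm_distance_lip0_le) simp
  finally show "\<bar>\<Lambda> (distance_lip0 (p j))\<bar> \<le> norm \<Lambda>" by simp
qed

lemma seminorm_SUP_dual_distance:
  "seminorm (\<lambda>\<Lambda> :: 'a::pointed_metric_space lip0_dual. SUP j::nat. \<bar>\<Lambda> (distance_lip0 (p j))\<bar>)"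
  unfolding seminorm_def
proof (intro conjI allI)
  note bdd = bdd_above_dual_distance[of _ p]
  fix \<Lambda> \<Gamma> :: "'a lip0_dual" and c :: real
  let ?\<rho> = "\<lambda>\<Lambda> :: 'a lip0_dual. SUP j::nat. \<bar>\<Lambda> (distance_lip0 (p j))\<bar>"
  have up: "\<bar>\<Lambda> (distance_lip0 (p j))\<bar> \<le> ?\<rho> \<Lambda>" for \<Lambda> :: "'a lip0_dual" and j
    by (rule cSUP_upper[OF UNIV_I bdd])
  show nonneg: "0 \<le> ?\<rho> \<Lambda>" for \<Lambda> :: "'a lip0_dual" using up[of \<Lambda> 0] by linarith
  show "?\<rho> (\<Lambda> + \<Gamma>) \<le> ?\<rho> \<Lambda> + ?\<rho> \<Gamma>"
  proof (rule cSUP_least)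
    fix j
    show "\<bar>(\<Lambda> + \<Gamma>) (distance_lip0 (p j))\<bar> \<le> ?\<rho> \<Lambda> + ?\<rho> \<Gamma>"
      using up[of \<Lambda> j] up[of \<Gamma> j] by (simp add: blinfun.add_left)
  qed simp
  have scale: "?\<rho> (c *\<^sub>R \<Lambda>) \<le> \<bar>c\<bar> * ?\<rho> \<Lambda>" for c and \<Lambda> :: "'a lip0_dual"
  proof (rule cSUP_least)
    fix j
    show "\<bar>(c *\<^sub>R \<Lambda>) (distance_lip0 (p j))\<bar> \<le> \<bar>c\<bar> * ?\<rho> \<Lambda>"
      using up[of \<Lambda> j] by (simp add: blinfun.scaleR_left abs_mult mult_left_mono)
  qed simp
  show "?\<rho> (c *\<^sub>R \<Lambda>) = \<bar>c\<bar> * ?\<rho> \<Lambda>"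
  proof (cases "c = 0")
    case True
    then show ?thesis using scale[of 0 \<Lambda>] nonneg[of 0] by simp
  next
    case False
    \<comment> \<open>The reverse inequality is the one-sided estimate for
      \<open>inverse c\<close>.\<close>
    have "\<bar>c\<bar> * ?\<rho> \<Lambda> \<le> \<bar>c\<bar> * (\<bar>inverse c\<bar> * ?\<rho> (c *\<^sub>R \<Lambda>))"
      using scale[of "inverse c" "c *\<^sub>R \<Lambda>"] False by (intro mult_left_mono) simp_all
    also have "\<dots> = ?\<rho> (c *\<^sub>R \<Lambda>)" using False by (simp flip: abs_mult mult.assoc)
    finally show ?thesis using scale[of c \<Lambda>] by simp
  qed
qed

text \<open>The isometry property of the Kuratowski embedding: a \<open>p j\<close> close to
  \<open>b\<close> makes the difference nearly \<open>dist a b\<close>, and the triangle inequality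
  forbids more.\<close>

lemma SUP_distance_diff_eq_dist:
  fixes p :: "nat \<Rightarrow> 'a::metric_space"
  assumes dense: "\<And>e. 0 < e \<Longrightarrow> \<exists>j. dist b (p j) < e"
  shows "(SUP j. \<bar>dist a (p j) - dist b (p j)\<bar>) = dist a b"
proof (rule antisym)
  show "(SUP j. \<bar>dist a (p j) - dist b (p j)\<bar>) \<le> dist a b"
    by (rule cSUP_least) (use abs_dist_diff_le in auto)
  have bdd: "bdd_above (range (\<lambda>j. \<bar>dist a (p j) - dist b (p j)\<bar>))"
    by (rule bdd_aboveI2[of _ _ "dist a b"]) (rule abs_dist_diff_le)
  show "dist a b \<le> (SUP j. \<bar>dist a (p j) - dist b (p j)\<bar>)"
  proof (rule field_le_epsilon)
    fix e :: real assume "0 < e"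
    then obtain j where "dist b (p j) < e / 2" using dense[of "e / 2"] by auto
    moreover have "\<bar>dist a (p j) - dist b (p j)\<bar> \<le> (SUP j. \<bar>dist a (p j) - dist b (p j)\<bar>)"
      by (rule cSUP_upper[OF UNIV_I bdd])
    ultimately show "dist a b \<le> (SUP j. \<bar>dist a (p j) - dist b (p j)\<bar>) + e"
      using dist_triangle[of a b "p j"] by (simp add: dist_commute)
  qed
qed

text \<open>The sequence enumerates the image of a countable dense subset of
  \<open>\<Omega>\<close>; separability comes from the Euclidean domain.\<close>

lemma Lipschitz_image_dense_sequence:
  fixes f :: "'b::euclidean_space \<Rightarrow> 'a::metric_space"
  assumes "\<Omega> \<noteq> {}" and f: "L-lipschitz_on \<Omega> f"
  shows "\<exists>p :: nat \<Rightarrow> 'a. \<forall>x\<in>\<Omega>. \<forall>e>0. \<exists>j. dist (f x) (p j) < e"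
proof -
  obtain T where T: "countable T" "T \<subseteq> \<Omega>" "\<Omega> \<subseteq> closure T" using separable[of \<Omega>] by blast
  then have "T \<noteq> {}" using assms(1) by auto
  have "\<exists>j. dist (f x) (f (from_nat_into T j)) < e" if x: "x \<in> \<Omega>" and "0 < e" for x e
  proof -
    have L: "0 \<le> L" using f by (rule lipschitz_on_nonneg)
    then have "0 < e / (L + 1)" using \<open>0 < e\<close> by simp
    then obtain y where y: "y \<in> T" "dist y x < e / (L + 1)"
      using T(3) x closure_approachable by (metis subset_iff)
    have "dist (f x) (f y) \<le> L * dist x y" using lipschitz_onD[OF f x] y(1) T(2) by blast
    also have "\<dots> \<le> (L + 1) * dist y x" by (simp add: dist_commute mult_right_mono)
    also have "\<dots> < e" using y(2) L by (simp add: field_simps)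
    finally show ?thesis using from_nat_into_surj[OF T(1) y(1)] by metis
  qed
  then show ?thesis by (intro exI[of _ "\<lambda>j. f (from_nat_into T j)"]) blast
qed

text \<open>The simultaneous Rademacher theorem is applied to extensions \<open>h j\<close> of the
  distance functions composed with \<open>f\<close>. On \<open>\<Omega>\<close> the supremum of
  their increments is \<open>dist (f y) (f x)\<close>, and the supremum of their derivatives is the
  seminorm evaluated on \<open>G x\<close>.\<close>

lemma AE_metric_differential_dual:
  fixes f :: "real ^ 'n \<Rightarrow> 'a::pointed_metric_space" and G :: "real ^ 'n \<Rightarrow> (real ^ 'n) \<Rightarrow>\<^sub>L 'a lip0_dual"
  assumes \<Omega>: "open \<Omega>" and f: "L-lipschitz_on \<Omega> f"
    and p: "\<And>x e. x \<in> \<Omega> \<Longrightarrow> 0 < e \<Longrightarrow> \<exists>j. dist (f x) (p j) < e"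
    and G: "\<And>x \<phi> \<nu>. x \<in> \<Omega> \<Longrightarrow> (lip0_apply \<phi> \<circ> f) differentiable (at x) \<Longrightarrow>
      G x \<nu> \<phi> = frechet_derivative (lip0_apply \<phi> \<circ> f) (at x) \<nu>"
  shows "AE x in lborel. x \<in> \<Omega> \<longrightarrow>
    has_metric_differential f (\<lambda>\<nu>. SUP j::nat. \<bar>G x \<nu> (distance_lip0 (p j))\<bar>) x"
proof (cases "\<Omega> = {}")
  case False
  let ?\<phi> = "\<lambda>j. distance_lip0 (p j)"
  have L: "0 \<le> L" using f by (rule lipschitz_on_nonneg)
  have "\<exists>g. (\<forall>x\<in>\<Omega>. g x = lip0_apply (?\<phi> j) (f x)) \<and> (\<forall>x y. \<bar>g x - g y\<bar> \<le> L * dist x y)" for j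
  proof (rule Lipschitz_extension_real[OF False L])
    fix x y assume "x \<in> \<Omega>" "y \<in> \<Omega>"
    then show "\<bar>lip0_apply (?\<phi> j) (f x) - lip0_apply (?\<phi> j) (f y)\<bar> \<le> L * dist x y"
      using abs_dist_diff_le[of "f x" "p j" "f y"] lipschitz_onD[OF f, of x y]
      by (simp add: distance_lip0_apply)
  qed
  then obtain h where h\<Omega>: "\<And>j x. x \<in> \<Omega> \<Longrightarrow> h j x = lip0_apply (?\<phi> j) (f x)"
    and h: "\<And>j x y. \<bar>h j x - h j y\<bar> \<le> L * dist x y" by metis
  have "AE x in lborel. \<exists>l. (\<forall>j. (h j has_derivative l j) (at x)) \<and>
    (\<forall>e>0. \<exists>d>0. \<forall>u. norm u < d \<longrightarrow>
       \<bar>(SUP j. \<bar>h j (x + u) - h j x\<bar>) - (SUP j. \<bar>l j u\<bar>)\<bar> \<le> e * norm u)"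
    by (rule Lipschitz_sequence_AE_differentiable) (use h in \<open>simp add: dist_norm\<close>)
  then show ?thesis
  proof eventually_elim
    case (elim x)
    show ?case
    proof
      assume x: "x \<in> \<Omega>"
      obtain l where l: "\<And>j. (h j has_derivative l j) (at x)"
        and o: "\<And>e. 0 < e \<Longrightarrow> \<exists>d>0. \<forall>u. norm u < d \<longrightarrow>
           \<bar>(SUP j. \<bar>h j (x + u) - h j x\<bar>) - (SUP j. \<bar>l j u\<bar>)\<bar> \<le> e * norm u"
        using elim by blast
      have Gl: "G x \<nu> (?\<phi> j) = l j \<nu>" for j \<nu>
      proof -
        \<comment> \<open>As \<open>\<Omega>\<close> is open, \<open>h j\<close> agrees with the
          composition near \<open>x\<close>.\<close>
        have "((lip0_apply (?\<phi> j) \<circ> f) has_derivative l j) (at x)"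
          by (rule has_derivative_transform_within_open[OF l \<Omega> x]) (simp add: h\<Omega>)
        then show ?thesis
          using G[OF x] frechet_derivative_at unfolding differentiable_def by metis
      qed
      have S: "(SUP j. \<bar>h j y - h j x\<bar>) = dist (f y) (f x)" if "y \<in> \<Omega>" for y
        using SUP_distance_diff_eq_dist[of "f x" p "f y", OF p[OF x]] that x
        by (simp add: h\<Omega> distance_lip0_apply)
      define \<sigma> where "\<sigma> \<nu> = (SUP j::nat. \<bar>G x \<nu> (?\<phi> j)\<bar>)" for \<nu>
      \<comment> \<open>A seminorm on the dual pulls back along the linear map
        \<open>G x\<close>.\<close>
      have "seminorm \<sigma>"
        using seminorm_SUP_dual_distance[of p] unfolding \<sigma>_def seminorm_def
        by (simp add: blinfun.add_right blinfun.scaleR_right)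
      moreover have "(\<lambda>y. dist (f y) (f x) - \<sigma> (y - x)) \<in> o[at x](\<lambda>y. norm (y - x))"
      proof (rule landau_o.smallI)
        fix c :: real assume "0 < c"
        then obtain d where d: "0 < d" "\<And>u. norm u < d \<Longrightarrow>
           \<bar>(SUP j. \<bar>h j (x + u) - h j x\<bar>) - (SUP j. \<bar>l j u\<bar>)\<bar> \<le> c * norm u" using o by blast
        \<comment> \<open>The supremum of the increments equals the distance only for
          \<open>y\<close> in \<open>\<Omega>\<close>, so \<open>y\<close> is kept in a ball inside
          it.\<close>
        obtain r where r: "0 < r" "ball x r \<subseteq> \<Omega>" using \<Omega> x openE by blast
        have "norm (dist (f y) (f x) - \<sigma> (y - x)) \<le> c * norm (norm (y - x))"
          if "dist y x < min d r" for y
        proof -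
          have "y \<in> \<Omega>" using that r(2) by (auto simp: dist_commute)
          then show ?thesis using d(2)[of "y - x"] that by (simp add: S \<sigma>_def Gl dist_norm)
        qed
        then show "\<forall>\<^sub>F y in at x. norm (dist (f y) (f x) - \<sigma> (y - x)) \<le> c * norm (norm (y - x))"
          unfolding eventually_at using d(1) r(1) by (intro exI[of _ "min d r"]) simp
      qed
      ultimately show "has_metric_differential f (\<lambda>\<nu>. SUP j::nat. \<bar>G x \<nu> (?\<phi> j)\<bar>) x"
        unfolding has_metric_differential_def \<sigma>_def by blast
    qed
  qed
qed simp

theorem theorem1p1:
  fixes \<Omega> :: "(real ^ 'n) set"
    and f :: "real ^ 'n \<Rightarrow> 'a::complete_pointed_metric_space"
  assumes "open \<Omega>"
    and "\<exists>L. L-lipschitz_on \<Omega> f"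
  shows "\<exists>G :: real ^ 'n \<Rightarrow> ((real ^ 'n) \<Rightarrow>\<^sub>L 'a lip0_dual).
      (\<forall>(\<phi> :: 'a lip0) \<nu>. \<forall>x\<in>\<Omega>. (lip0_apply \<phi> \<circ> f) differentiable (at x) \<longrightarrow>
         blinfun_apply (blinfun_apply (G x) \<nu>) \<phi> = frechet_derivative (lip0_apply \<phi> \<circ> f) (at x) \<nu>)
    \<and> (\<exists>\<rho> :: 'a lip0_dual \<Rightarrow> real. seminorm \<rho> \<and>
         (\<forall>\<nu>. AE x\<in>\<Omega> in lebesgue.
            metrically_differentiable f x \<and> md f x \<nu> = \<rho> (blinfun_apply (G x) \<nu>)))"
proof -
  obtain L where f: "L-lipschitz_on \<Omega> f" using assms(2) by blast
  \<comment> \<open>For empty \<open>\<Omega>\<close> any sequence serves.\<close>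
  obtain p where p: "\<And>x e. x \<in> \<Omega> \<Longrightarrow> 0 < e \<Longrightarrow> \<exists>j::nat. dist (f x) (p j) < e"
    using Lipschitz_image_dense_sequence[OF _ f] by (cases "\<Omega> = {}") auto
  have "\<forall>x\<in>\<Omega>. \<exists>G :: (real ^ 'n) \<Rightarrow>\<^sub>L 'a lip0_dual. \<forall>\<phi> \<nu>. (lip0_apply \<phi> \<circ> f) differentiable (at x) \<longrightarrow>
     G \<nu> \<phi> = frechet_derivative (lip0_apply \<phi> \<circ> f) (at x) \<nu>"
    using dual_gradient_exists[OF assms(1) _ f] by blast
  then obtain G :: "real ^ 'n \<Rightarrow> (real ^ 'n) \<Rightarrow>\<^sub>L 'a lip0_dual" where
    G: "\<And>x \<phi> \<nu>. x \<in> \<Omega> \<Longrightarrow> (lip0_apply \<phi> \<circ> f) differentiable (at x) \<Longrightarrow>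
      G x \<nu> \<phi> = frechet_derivative (lip0_apply \<phi> \<circ> f) (at x) \<nu>" by metis
  let ?\<rho> = "\<lambda>\<Lambda> :: 'a lip0_dual. SUP j::nat. \<bar>\<Lambda> (distance_lip0 (p j))\<bar>"
  \<comment> \<open>The exceptional null set is common to all \<open>\<nu>\<close>.\<close>
  have md: "AE x in lborel. x \<in> \<Omega> \<longrightarrow> has_metric_differential f (\<lambda>\<nu>. ?\<rho> (G x \<nu>)) x"
    by (rule AE_metric_differential_dual[OF assms(1) f p G])
  \<comment> \<open>The statement passes from Borel Lebesgue measure to its completion, and
    uniqueness of the metric differential evaluates \<open>md\<close>.\<close>
  have "AE x\<in>\<Omega> in lebesgue. metrically_differentiable f x \<and> md f x \<nu> = ?\<rho> (G x \<nu>)" for \<nu>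
    using AE_completion[OF md]
    by eventually_elim (auto simp: metrically_differentiable_def md_eq)
  with seminorm_SUP_dual_distance[of p] G show ?thesis
    by (intro exI[of _ G] conjI exI[of _ ?\<rho>]) blast+
qed

end
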